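(* Let $\gamma\le0$ and assume (Increments), (Waiting times), (Integrability) and (Full support) as described in the context. Let $(\bar v^\gamma,\bar\lambda^\gamma)\in\mathcal{C}_b(\mathcal{S})\times\mathbb{R}$ be a fixed solution to the Bellman equation $$\bar v^\gamma(\pi)=\sup_{\pi'\in\mathcal{S}}\Big(\ln s(\pi,\pi')-\bar\lambda^\gamma\,\mathbb{E}[\eta_1]+\mu^\gamma\big[\ln\langle \pi',R(\eta_1)\rangle+\bar v^\gamma(G(\pi',R(\eta_1)))\big]\Big),\qquad \pi\in\mathcal{S},$$ with concave lift, i.e. such that $\mathcal{W}_{\bar v^\gamma}$ is concave on $\mathbb{R}^d_+$. Then, for any $\pi\in\mathcal{S}$, the supremum on the right-hand side is attained at exactly one point $\hat\pi(\pi)\in\mathcal{S}$. Moreover, the map $\mathcal{S}\ni\pi\mapsto\hat\pi(\pi)\in\mathcal{S}$ is continuous.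
   Context: Notation. $d\ge1$; $\langle x,y\rangle$ is the scalar product, $x\cdot y$ the component-wise product on $\mathbb{R}^d$; $\mathbf{1}=(1,\dots,1)$. $\mathcal{S}=\{\pi\in\mathbb{R}^d:\pi_i\ge0,\ \langle\pi,\mathbf{1}\rangle=1\}$, $\mathcal{S}_0=\{\pi\in\mathcal{S}:\pi_i>0\ \forall i\}$; $\mathcal{C}_b(\mathcal{S})$ is the space of bounded continuous real functions on $\mathcal{S}$. $G(x,y):=\frac{x\cdot y}{\langle x,y\rangle}$. Transaction costs. $c_i,h_i\in[0,1)$, $i=1,\dots,d$; $p(x):=\sum_{i=1}^d\max(c_ix_i,-h_ix_i)$. For $\pi,\pi'\in\mathcal{S}$, $s(\pi,\pi')$ denotes the unique $w>0$ with $w+p(w\pi'-\pi)=1$. Market. $S(t)=(S_1(t),\dots,S_d(t))$, $t\ge0$, is a process of strictly positive prices, $R(t_1,t_2)=(S_i(t_2)/S_i(t_1))_{i}$, $R(t)=R(0,t)$, $r(t)=\ln R(t)$ (component-wise). $(\eta_i)_{i\ge1}$ are i.i.d. $(0,\infty)$-valued random variables, independent of the price process. (Increments): $t\mapsto\ln S(t)$ is right-continuous and has stationary independent increments. (Waiting times): $\mathbb{P}[\eta_i>0]=1$ and $\mathbb{E}[\eta_i]<\infty$. (Integrability): for any $\gamma<0$, $\mathbb{E}[e^{\gamma\min_i r_i(\eta_1)}]<\infty$, and $\mathbb{E}[\max_i r_i(\eta_1)]<\infty$. (Full support): for any $\pi\in\mathcal{S}_0$, $t>0$ and any non-empty (relatively)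 open $C\subset\mathcal{S}$, $\mathbb{P}[G(\pi,R(t))\in C]>0$. Entropic utility. $\mu^\gamma[Z]:=\frac1\gamma\ln\mathbb{E}[e^{\gamma Z}]$ for $\gamma<0$ and $\mu^0[Z]:=\mathbb{E}[Z]$. Lift. For $v\in\mathcal{C}_b(\mathcal{S})$: $\mathcal{W}_v(x):=\langle x,\mathbf{1}\rangle e^{v(x/\langle x,\mathbf{1}\rangle)}$ for $x\in\mathbb{R}^d_+\setminus\{\mathbf{0}\}$, $\mathcal{W}_v(\mathbf{0}):=0$. *)

theory Defs
  imports "HOL-Probability.Probability"
begin

text \<open>The dimension is \<open>d = CARD('d)\<close>. On \<open>real ^ 'd\<close>, \<open>x * y\<close> is the component-wise product
  and \<open>1\<close> is the vector of ones, so \<open>x \<bullet> 1\<close> is the sum of the components of \<open>x\<close>.\<close>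

definition prob_simplex :: "(real ^ 'd) set" where
  "prob_simplex = {\<pi>. (\<forall>i. 0 \<le> \<pi> $ i) \<and> \<pi> \<bullet> 1 = 1}"

definition prob_simplex0 :: "(real ^ 'd) set" where
  "prob_simplex0 = {\<pi> \<in> prob_simplex. \<forall>i. 0 < \<pi> $ i}"

definition orthant :: "(real ^ 'd) set" where
  "orthant = {x. \<forall>i. 0 \<le> x $ i}"

definition G :: "real ^ 'd \<Rightarrow> real ^ 'd \<Rightarrow> real ^ 'd" where
  "G x y = (x * y) /\<^sub>R (x \<bullet> y)"

definition cost :: "real ^ 'd \<Rightarrow> real ^ 'd \<Rightarrow> real ^ 'd \<Rightarrow> real" where
  "cost c h x = (\<Sum>i\<in>UNIV. max (c $ i * x $ i) (- (h $ i) * x $ i))"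

lemma shrink_ex1:
  fixes c h p q :: "real ^ 'd"
  assumes ch: "\<forall>i. 0 \<le> c $ i \<and> c $ i < 1" "\<forall>i. 0 \<le> h $ i \<and> h $ i < 1"
    and pq: "p \<in> prob_simplex" "q \<in> prob_simplex"
  shows "\<exists>!w. 0 < w \<and> w + cost c h (w *\<^sub>R q - p) = 1"
proof -
  have pq': "\<forall>i. 0 \<le> p $ i" "(\<Sum>i\<in>UNIV. p $ i) = 1" "\<forall>i. 0 \<le> q $ i" "(\<Sum>i\<in>UNIV. q $ i) = 1"
    using pq by (auto simp: prob_simplex_def inner_vec_def)
  define f where "f w = w + cost c h (w *\<^sub>R q - p)" for w
  have lt1: "(\<Sum>i\<in>UNIV. h $ i * r $ i) < 1" if r: "\<forall>i. 0 \<le> r $ i" "(\<Sum>i\<in>UNIV. r $ i) = 1"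
    for r :: "real ^ 'd"
  proof -
    obtain i where i: "r $ i > 0"
      using r by (metis order_le_less sum.neutral zero_neq_one)
    have le: "h $ j * r $ j \<le> r $ j" for j
      using ch(2) r(1) by (intro mult_left_le_one_le) (auto simp: less_imp_le)
    have lt: "h $ i * r $ i < r $ i"
      using ch(2) i by simp
    have "(\<Sum>i\<in>UNIV. h $ i * r $ i) < (\<Sum>i\<in>UNIV. r $ i)"
      using le lt by (intro sum_strict_mono_ex1) auto
    thus ?thesis using r by simp
  qed
  have mono: "f a < f b" if ab: "a < b" for a b
  proof -
    have *: "max (c $ i * (a *\<^sub>R q - p) $ i) (- (h $ i) * (a *\<^sub>R q - p) $ i) - (b - a) * (h $ i * q $ i)
        \<le> max (c $ i * (b *\<^sub>R q - p) $ i) (- (h $ i) * (b *\<^sub>R q - p) $ i)" for i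
    proof -
      have 1: "0 \<le> (b - a) * (h $ i * q $ i)"
        using ab ch(2) pq'(3) by (intro mult_nonneg_nonneg) auto
      have "a * q $ i \<le> b * q $ i"
        using ab pq'(3) by (intro mult_right_mono) auto
      hence 2: "c $ i * (a * q $ i - p $ i) \<le> c $ i * (b * q $ i - p $ i)"
        using ch(1) by (intro mult_left_mono) auto
      have 3: "- (h $ i) * (a * q $ i - p $ i) - (b - a) * (h $ i * q $ i) = - (h $ i) * (b * q $ i - p $ i)"
        by (simp add: algebra_simps)
      have 4: "max u v - d \<le> max u' v'" if "0 \<le> d" "u \<le> u'" "v - d = v'" for u v d u' v' :: real
        using that by linarith
      show ?thesis using 4[OF 1 2 3] by simp
    qed
    have "cost c h (a *\<^sub>R q - p) - (b - a) * (\<Sum>i\<in>UNIV. h $ i * q $ i) \<le> cost c h (b *\<^sub>R q - p)"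
      unfolding cost_def sum_distrib_left sum_subtractf[symmetric] by (rule sum_mono) (rule *)
    moreover have "(b - a) * (\<Sum>i\<in>UNIV. h $ i * q $ i) < b - a"
      using lt1[OF pq'(3,4)] ab by simp
    ultimately show ?thesis unfolding f_def by linarith
  qed
  have f0: "f 0 < 1"
  proof -
    have "max (c $ i * (- p $ i)) (- (h $ i) * (- p $ i)) = h $ i * p $ i" for i
    proof -
      have "0 \<le> c $ i * p $ i" "0 \<le> h $ i * p $ i" using ch pq'(1) by simp_all
      thus ?thesis by simp
    qed
    hence "f 0 = (\<Sum>i\<in>UNIV. h $ i * p $ i)" by (simp add: f_def cost_def)
    thus ?thesis using lt1[OF pq'(1,2)] by simp
  qed
  have f1: "1 \<le> f 1"
  proof -
    have "0 \<le> max (c $ i * x) (- (h $ i) * x)" for x i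
    proof (cases "0 \<le> x")
      case True
      thus ?thesis using ch(1) by (simp add: le_max_iff_disj)
    next
      case False
      hence "0 \<le> - (h $ i) * x" using ch(2) by (simp add: mult_nonneg_nonpos)
      thus ?thesis by linarith
    qed
    hence "0 \<le> cost c h (1 *\<^sub>R q - p)" unfolding cost_def by (intro sum_nonneg)
    thus ?thesis by (simp add: f_def)
  qed
  have "continuous_on {0..1} f" unfolding f_def cost_def by (intro continuous_intros)
  then obtain w where w: "0 \<le> w" "f w = 1" using IVT'[of f 0 1 1] f0 f1 by auto
  have "w \<noteq> 0" using f0 w by auto
  hence "0 < w" using w by simp
  moreover have "u = w" if "f u = 1" for u
    using mono[of u w] mono[of w u] that w by linarith
  ultimately show ?thesis
    unfolding f_def[symmetric] using w by blast
qed

definition shrink :: "real ^ 'd \<Rightarrow> real ^ 'd \<Rightarrow> real ^ 'd \<Rightarrow> real ^ 'd \<Rightarrow> real" where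
  "shrink c h \<pi> \<pi>' = (THE w. 0 < w \<and> w + cost c h (w *\<^sub>R \<pi>' - \<pi>) = 1)"

definition log_price :: "(real \<Rightarrow> 'a \<Rightarrow> real ^ 'd) \<Rightarrow> real \<Rightarrow> 'a \<Rightarrow> real ^ 'd" where
  "log_price S t \<omega> = (\<chi> i. ln (S t \<omega> $ i))"

definition ret :: "(real \<Rightarrow> 'a \<Rightarrow> real ^ 'd) \<Rightarrow> real \<Rightarrow> real \<Rightarrow> 'a \<Rightarrow> real ^ 'd" where
  "ret S t1 t2 \<omega> = (\<chi> i. S t2 \<omega> $ i / S t1 \<omega> $ i)"

definition log_ret :: "(real \<Rightarrow> 'a \<Rightarrow> real ^ 'd) \<Rightarrow> real \<Rightarrow> 'a \<Rightarrow> real ^ 'd" where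
  "log_ret S t \<omega> = (\<chi> i. ln (ret S 0 t \<omega> $ i))"

definition price_process :: "'a measure \<Rightarrow> (real \<Rightarrow> 'a \<Rightarrow> real ^ 'd) \<Rightarrow> bool" where
  "price_process M S \<longleftrightarrow>
     (\<forall>t\<ge>0. S t \<in> borel_measurable M \<and> (\<forall>\<omega>\<in>space M. \<forall>i. 0 < S t \<omega> $ i))"

text \<open>The waiting times are indexed by \<open>i \<ge> 1\<close>. The last conjunct is joint: the whole sequence
  of waiting times is independent of the whole price path.\<close>

definition iid_times :: "'a measure \<Rightarrow> (real \<Rightarrow> 'a \<Rightarrow> real ^ 'd) \<Rightarrow> (nat \<Rightarrow> 'a \<Rightarrow> real) \<Rightarrow> bool" where
  "iid_times M S \<eta> \<longleftrightarrow>
     (\<forall>i\<ge>1. \<forall>\<omega>\<in>space M. 0 < \<eta> i \<omega>) \<and>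
     prob_space.indep_vars M (\<lambda>_. borel) \<eta> {1..} \<and>
     (\<forall>i\<ge>1. distr M borel (\<eta> i) = distr M borel (\<eta> 1)) \<and>
     prob_space.indep_set M
       (sets (vimage_algebra (space M) (\<lambda>\<omega>. \<lambda>i\<in>{1..}. \<eta> i \<omega>) (PiM {1..} (\<lambda>_. borel))))
       (sets (vimage_algebra (space M) (\<lambda>\<omega>. \<lambda>t\<in>{0..}. S t \<omega>) (PiM {0..} (\<lambda>_. borel))))"

definition increments :: "'a measure \<Rightarrow> (real \<Rightarrow> 'a \<Rightarrow> real ^ 'd) \<Rightarrow> bool" where
  "increments M S \<longleftrightarrow>
     (\<forall>\<omega>\<in>space M. \<forall>t\<ge>0. continuous (at_right t) (\<lambda>u. log_price S u \<omega>)) \<and>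
     (\<forall>t\<ge>0. \<forall>u\<ge>0.
        distr M borel (\<lambda>\<omega>. log_price S (t + u) \<omega> - log_price S t \<omega>) =
        distr M borel (\<lambda>\<omega>. log_price S u \<omega> - log_price S 0 \<omega>)) \<and>
     (\<forall>(n::nat) (t :: nat \<Rightarrow> real). 0 \<le> t 0 \<and> strict_mono_on {..n} t \<longrightarrow>
        prob_space.indep_vars M (\<lambda>_. borel)
          (\<lambda>k \<omega>. log_price S (t (Suc k)) \<omega> - log_price S (t k) \<omega>) {..<n})"

definition waiting_times :: "'a measure \<Rightarrow> (nat \<Rightarrow> 'a \<Rightarrow> real) \<Rightarrow> bool" where
  "waiting_times M \<eta> \<longleftrightarrow>
     (\<forall>i\<ge>1. measure M {\<omega> \<in> space M. 0 < \<eta> i \<omega>} = 1 \<and> integrable M (\<eta> i))"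

text \<open>The first conjunct makes the negative part of the maximum integrable, so that a finite
  expectation of the maximum means integrability.\<close>

definition integrability :: "'a measure \<Rightarrow> (real \<Rightarrow> 'a \<Rightarrow> real ^ 'd) \<Rightarrow> (nat \<Rightarrow> 'a \<Rightarrow> real) \<Rightarrow> bool" where
  "integrability M S \<eta> \<longleftrightarrow>
     (\<forall>\<gamma><0. integrable M (\<lambda>\<omega>. exp (\<gamma> * (MIN i. log_ret S (\<eta> 1 \<omega>) \<omega> $ i)))) \<and>
     integrable M (\<lambda>\<omega>. MAX i. log_ret S (\<eta> 1 \<omega>) \<omega> $ i)"

definition full_support :: "'a measure \<Rightarrow> (real \<Rightarrow> 'a \<Rightarrow> real ^ 'd) \<Rightarrow> bool" where
  "full_support M S \<longleftrightarrow>
     (\<forall>\<pi>\<in>prob_simplex0. \<forall>t>0. \<forall>C. openin (top_of_set prob_simplex) C \<and> C \<noteq> {} \<longrightarrow>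
        0 < measure M {\<omega> \<in> space M. G \<pi> (ret S 0 t \<omega>) \<in> C})"

definition entropic :: "'a measure \<Rightarrow> real \<Rightarrow> ('a \<Rightarrow> real) \<Rightarrow> real" where
  "entropic M \<gamma> Z =
     (if \<gamma> = 0 then (\<integral>\<omega>. Z \<omega> \<partial>M) else 1 / \<gamma> * ln (\<integral>\<omega>. exp (\<gamma> * Z \<omega>) \<partial>M))"

definition lift :: "(real ^ 'd \<Rightarrow> real) \<Rightarrow> real ^ 'd \<Rightarrow> real" where
  "lift v x = (if x = 0 then 0 else (x \<bullet> 1) * exp (v (x /\<^sub>R (x \<bullet> 1))))"

definition bellman_obj ::
  "'a measure \<Rightarrow> (real \<Rightarrow> 'a \<Rightarrow> real ^ 'd) \<Rightarrow> (nat \<Rightarrow> 'a \<Rightarrow> real) \<Rightarrow> real ^ 'd \<Rightarrow> real ^ 'd \<Rightarrow>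
   real \<Rightarrow> (real ^ 'd \<Rightarrow> real) \<Rightarrow> real \<Rightarrow> real ^ 'd \<Rightarrow> real ^ 'd \<Rightarrow> real" where
  "bellman_obj M S \<eta> c h \<gamma> v lam \<pi> \<pi>' =
     ln (shrink c h \<pi> \<pi>') - lam * (\<integral>\<omega>. \<eta> 1 \<omega> \<partial>M) +
     entropic M \<gamma> (\<lambda>\<omega>. ln (\<pi>' \<bullet> ret S 0 (\<eta> 1 \<omega>) \<omega>) + v (G \<pi>' (ret S 0 (\<eta> 1 \<omega>) \<omega>)))"

text \<open>The supremum is taken in the extended reals, where it always has its usual meaning.\<close>

definition bellman_sup ::
  "'a measure \<Rightarrow> (real \<Rightarrow> 'a \<Rightarrow> real ^ 'd) \<Rightarrow> (nat \<Rightarrow> 'a \<Rightarrow> real) \<Rightarrow> real ^ 'd \<Rightarrow> real ^ 'd \<Rightarrow>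
   real \<Rightarrow> (real ^ 'd \<Rightarrow> real) \<Rightarrow> real \<Rightarrow> real ^ 'd \<Rightarrow> ereal" where
  "bellman_sup M S \<eta> c h \<gamma> v lam \<pi> =
     (SUP \<pi>'\<in>prob_simplex. ereal (bellman_obj M S \<eta> c h \<gamma> v lam \<pi> \<pi>'))"

definition bellman_attained ::
  "'a measure \<Rightarrow> (real \<Rightarrow> 'a \<Rightarrow> real ^ 'd) \<Rightarrow> (nat \<Rightarrow> 'a \<Rightarrow> real) \<Rightarrow> real ^ 'd \<Rightarrow> real ^ 'd \<Rightarrow>
   real \<Rightarrow> (real ^ 'd \<Rightarrow> real) \<Rightarrow> real \<Rightarrow> real ^ 'd \<Rightarrow> real ^ 'd \<Rightarrow> bool" where
  "bellman_attained M S \<eta> c h \<gamma> v lam \<pi> \<pi>' \<longleftrightarrow>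
     \<pi>' \<in> prob_simplex \<and>
     ereal (bellman_obj M S \<eta> c h \<gamma> v lam \<pi> \<pi>') = bellman_sup M S \<eta> c h \<gamma> v lam \<pi>"

end

theory Submission
  imports Defs
begin

text \<open>Write \<open>W\<close> for the lift of \<open>v\<close> and \<open>R\<close> for the vector of returns over the first waiting
  time. Since \<open>W\<close> is positively homogeneous, \<open>ln \<langle>q, R\<rangle> + v (G q R) = ln (W (q \<cdot> R))\<close>, so that with
  \<open>U(x) = \<mu>\<^sup>\<gamma>[ln W(x \<cdot> R)]\<close> the objective at a portfolio \<open>q\<close> is, up to a constant, \<open>ln s + U(q) = U(s q)\<close>,
  where \<open>s\<close> is the factor by which the costs of trading from \<open>\<pi>\<close> to \<open>q\<close> shrink the wealth.
  Choosing \<open>q\<close> is therefore the same as choosing a position \<open>x = s q\<close> on the boundary of the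
  budget set \<open>{x. \<langle>x, 1\<rangle> + p(x - \<pi>) \<le> 1}\<close>, which is convex because the cost \<open>p\<close> is.

  \<^bold>\<open>Uniqueness.\<close> Let two portfolios be optimal, with positions \<open>x\<close> and \<open>y\<close>. The midpoint \<open>m\<close> is
  affordable, and scaling it up to the boundary only helps, so \<open>U(m) \<le> U(x) = U(y)\<close>. On the other
  hand \<open>W\<close> is concave and \<open>ln\<close> strictly concave, so \<open>ln W(m \<cdot> R)\<close> is at least the mean of
  \<open>ln W(x \<cdot> R)\<close> and \<open>ln W(y \<cdot> R)\<close>, and exceeds it wherever \<open>W(x \<cdot> R) \<noteq> W(y \<cdot> R)\<close>. Entropic
  utility turns this into \<open>W(x \<cdot> R) = W(y \<cdot> R)\<close> almost surely
  (\<open>AE_eq_if_entropic_midpoint_le\<close>). The lift may well be linear, so concavity says nothing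
  more, and this is where full support enters: by homogeneity the equality concerns only the direction of \<open>R\<close>, whose law
  charges every open subset of the simplex, so by continuity \<open>W(x \<cdot> \<rho>) = W(y \<cdot> \<rho>)\<close> for every \<open>\<rho>\<close> in
  the simplex. At the vertex \<open>\<rho> = e\<^sub>i\<close> this reads \<open>x\<^sub>i W(e\<^sub>i) = y\<^sub>i W(e\<^sub>i)\<close> with \<open>W(e\<^sub>i) > 0\<close>, whence
  \<open>x = y\<close> (\<open>lift_separating\<close>).

  \<^bold>\<open>Existence and continuity.\<close> The objective is jointly continuous on the product of two simplices:
  \<open>U\<close> by dominated convergence, with dominating functions supplied by the integrability condition, and
  the shrinkage factor because it is bounded and has a closed graph. On a compact set a maximizer
  exists, and a unique maximizer of a jointly continuous function depends continuously on the
  parameter, again by the closed graph theorem for compact ranges.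

  \<^bold>\<open>The random time.\<close> The assumptions on the prices concern fixed times, whereas \<open>R\<close> is evaluated at
  the waiting time. Right-continuity makes the returns jointly measurable in time and scenario,
  and independence lets Fubini's theorem transfer positivity of probabilities from every fixed
  time to the waiting time (\<open>prob_at_independent_time_pos\<close>).\<close>

section \<open>The simplex and the orthant\<close>

lemma inner_one_eq_sum: "(x :: real ^ 'd) \<bullet> 1 = (\<Sum>i\<in>UNIV. x $ i)"
  by (simp add: inner_vec_def)

lemma mult_inner_one: "((x :: real ^ 'd) * y) \<bullet> 1 = x \<bullet> y"
  by (simp add: inner_vec_def)

lemma closed_orthant: "closed (orthant :: (real ^ 'd) set)"
proof -
  have eq: "orthant = (\<Inter>i. {x :: real ^ 'd. 0 \<le> x $ i})"
    by (auto simp: orthant_def)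
  show ?thesis
    unfolding eq by (intro closed_INT ballI closed_Collect_le continuous_intros)
qed

lemma orthant_mult: "x \<in> orthant \<Longrightarrow> y \<in> orthant \<Longrightarrow> x * y \<in> orthant"
  by (simp add: orthant_def)

lemma orthant_scaleR: "x \<in> orthant \<Longrightarrow> 0 \<le> a \<Longrightarrow> a *\<^sub>R x \<in> orthant"
  by (simp add: orthant_def)

lemma orthant_inner_one_pos:
  fixes x :: "real ^ 'd"
  assumes "x \<in> orthant" "x \<noteq> 0"
  shows "0 < x \<bullet> 1"
proof -
  obtain i where i: "x $ i \<noteq> 0"
    using assms(2) by (auto simp: vec_eq_iff)
  have "0 < x $ i"
    using i assms(1) by (auto simp: orthant_def less_le)
  thus ?thesis
    unfolding inner_one_eq_sum using assms(1)
    by (intro sum_pos2[of _ i]) (auto simp: orthant_def)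
qed

lemma orthant_normalize:
  assumes "x \<in> orthant" "x \<noteq> 0"
  shows "x /\<^sub>R (x \<bullet> 1) \<in> prob_simplex"
  using assms orthant_inner_one_pos[OF assms]
  by (auto simp: prob_simplex_def orthant_def)

lemma simplex_orthant: "x \<in> prob_simplex \<Longrightarrow> x \<in> orthant"
  by (simp add: prob_simplex_def orthant_def)

lemma simplex_nonzero: "x \<in> prob_simplex \<Longrightarrow> x \<noteq> 0"
  by (auto simp: prob_simplex_def)

lemma axis_in_simplex: "axis i 1 \<in> (prob_simplex :: (real ^ 'd) set)"
  by (simp add: prob_simplex_def inner_one_eq_sum axis_def)

lemma continuous_on_vec_mult [continuous_intros]:
  fixes f g :: "'a :: topological_space \<Rightarrow> real ^ 'd"
  assumes "continuous_on A f" "continuous_on A g"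
  shows "continuous_on A (\<lambda>x. f x * g x)"
  unfolding times_vec_def using assms by (intro continuous_intros)

lemma mult_pos_vec_nonzero:
  fixes x y :: "real ^ 'd"
  assumes "x \<noteq> 0" "\<And>i. 0 < y $ i"
  shows "x * y \<noteq> 0"
proof -
  obtain i where "x $ i \<noteq> 0"
    using assms(1) by (auto simp: vec_eq_iff)
  hence "(x * y) $ i \<noteq> 0"
    using assms(2)[of i] by simp
  thus ?thesis by (metis zero_index)
qed

lemma compact_prob_simplex: "compact (prob_simplex :: (real ^ 'd) set)"
proof -
  have eq: "prob_simplex = orthant \<inter> {x :: real ^ 'd. x \<bullet> 1 = 1}"
    by (auto simp: prob_simplex_def orthant_def)
  have "closed (prob_simplex :: (real ^ 'd) set)"
    unfolding eq by (intro closed_Int closed_orthant closed_Collect_eq continuous_intros)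
  moreover have "bounded (prob_simplex :: (real ^ 'd) set)"
  proof (rule boundedI)
    fix x :: "real ^ 'd"
    assume x: "x \<in> prob_simplex"
    have "norm x \<le> (\<Sum>i\<in>UNIV. \<bar>x $ i\<bar>)"
      by (rule norm_le_l1_cart)
    also have "\<dots> = (\<Sum>i\<in>UNIV. x $ i)"
      using x by (intro sum.cong) (auto simp: prob_simplex_def)
    also have "\<dots> = 1"
      using x by (simp add: prob_simplex_def inner_one_eq_sum)
    finally show "norm x \<le> 1" .
  qed
  ultimately show ?thesis by (simp add: compact_eq_bounded_closed)
qed

lemma simplex_inner_bounds:
  fixes x r :: "real ^ 'd"
  assumes x: "x \<in> prob_simplex" and r: "\<And>i. a \<le> r $ i" "\<And>i. r $ i \<le> b"
  shows "a \<le> x \<bullet> r" "x \<bullet> r \<le> b"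
proof -
  have s: "(\<Sum>i\<in>UNIV. x $ i) = 1" "\<And>i. 0 \<le> x $ i"
    using x by (auto simp: prob_simplex_def inner_one_eq_sum)
  have "a = (\<Sum>i\<in>UNIV. x $ i * a)"
    using s by (simp flip: sum_distrib_right)
  also have "\<dots> \<le> x \<bullet> r"
    unfolding inner_vec_def using s r by (auto intro!: sum_mono mult_left_mono)
  finally show "a \<le> x \<bullet> r" .
  have "x \<bullet> r \<le> (\<Sum>i\<in>UNIV. x $ i * b)"
    unfolding inner_vec_def using s r by (auto intro!: sum_mono mult_left_mono)
  also have "\<dots> = b"
    using s by (simp flip: sum_distrib_right)
  finally show "x \<bullet> r \<le> b" .
qed

lemma continuous_on_simplex_bounded:
  fixes f :: "real ^ 'd \<Rightarrow> real"
  assumes "continuous_on prob_simplex f"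
  obtains K where "\<And>x. x \<in> prob_simplex \<Longrightarrow> \<bar>f x\<bar> \<le> K"
  using compact_imp_bounded[OF compact_continuous_image[OF assms compact_prob_simplex]]
  by (auto simp: bounded_iff)

section \<open>The lift\<close>

lemma lift_pos:
  assumes "x \<in> orthant" "x \<noteq> 0"
  shows "0 < lift v x"
  using assms orthant_inner_one_pos[OF assms] by (simp add: lift_def)

lemma lift_scaleR:
  assumes "0 \<le> a"
  shows "lift v (a *\<^sub>R x) = a * lift v x"
proof (cases "a = 0 \<or> x = 0")
  case False
  hence "inverse (a * (x \<bullet> 1)) * a = inverse (x \<bullet> 1)"
    by (cases "x \<bullet> 1 = 0") (simp_all add: field_simps)
  hence eq: "(a *\<^sub>R x) /\<^sub>R ((a *\<^sub>R x) \<bullet> 1) = x /\<^sub>R (x \<bullet> 1)"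
    by (metis inner_scaleR_left scaleR_scaleR)
  show ?thesis using False unfolding lift_def by (simp only: eq) simp
qed (auto simp: lift_def)

lemma lift_mult_eq:
  assumes "x * y \<noteq> 0"
  shows "lift v (x * y) = (x \<bullet> y) * exp (v (G x y))"
  using assms by (simp add: lift_def G_def mult_inner_one)

text \<open>Away from the origin this is a composition of continuous maps. The normalization breaks down at
  the origin, but there the lift is squeezed to zero since \<open>v\<close> is bounded above.\<close>

lemma continuous_on_lift:
  fixes v :: "real ^ 'd \<Rightarrow> real"
  assumes v: "continuous_on prob_simplex v"
  shows "continuous_on orthant (lift v)"
proof -
  obtain K where K: "\<And>x. x \<in> prob_simplex \<Longrightarrow> \<bar>v x\<bar> \<le> K"
    using continuous_on_simplex_bounded[OF v] by blast
  have "continuous_on (orthant - {0}) (\<lambda>x. (x \<bullet> 1) * exp (v (x /\<^sub>R (x \<bullet> 1))))"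
  proof (intro continuous_intros continuous_on_compose2[OF v])
    show "\<forall>x\<in>orthant - {0}. x \<bullet> 1 \<noteq> 0"
      using orthant_inner_one_pos by force
    show "(\<lambda>x. x /\<^sub>R (x \<bullet> 1)) ` (orthant - {0}) \<subseteq> prob_simplex"
      using orthant_normalize by blast
  qed
  also have "?this \<longleftrightarrow> continuous_on (orthant - {0}) (lift v)"
    by (intro continuous_on_cong) (auto simp: lift_def)
  finally have away: "continuous_on (orthant - {0}) (lift v)" .
  have "(lift v \<longlongrightarrow> lift v x) (at x within orthant)" if x: "x \<in> orthant" for x
  proof (cases "x = 0")
    case True
    have "\<forall>\<^sub>F y in at x within orthant. norm (lift v y) \<le> (y \<bullet> 1) * exp K"
      unfolding eventually_at_filter
    proof (intro always_eventually allI impI)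
      fix y assume y: "y \<noteq> x" "y \<in> orthant"
      have "v (y /\<^sub>R (y \<bullet> 1)) \<le> K"
        using K[OF orthant_normalize[of y]] y True by auto
      thus "norm (lift v y) \<le> (y \<bullet> 1) * exp K"
        using y True orthant_inner_one_pos[of y] by (simp add: lift_def abs_mult)
    qed
    moreover have "((\<lambda>y. (y \<bullet> 1) * exp K) \<longlongrightarrow> (x \<bullet> 1) * exp K) (at x within orthant)"
      by (intro tendsto_intros)
    ultimately show ?thesis
      using True by (auto simp: lift_def intro: Lim_null_comparison)
  next
    case False
    have "at x within (orthant - {0}) = at x within orthant"
      by (rule at_within_nhd[of _ "- {0}"]) (use False in auto)
    thus ?thesis
      using away x False unfolding continuous_on_def by force
  qed
  thus ?thesis by (simp add: continuous_on_def)
qed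

text \<open>The arithmetic-geometric mean inequality with its equality case: the only source of
  strictness in the whole argument.\<close>

lemma geometric_mean_le:
  fixes a b c :: real
  assumes "0 < a" "0 < b" "(a + b) / 2 \<le> c"
  shows "(ln a + ln b) / 2 \<le> ln c" "a \<noteq> b \<Longrightarrow> (ln a + ln b) / 2 < ln c"
proof -
  have c: "0 < c" using assms by (intro less_le_trans[of 0 "(a + b) / 2" c]) auto
  have "((a + b) / 2)\<^sup>2 \<le> c\<^sup>2"
    using assms by (intro power_mono) auto
  moreover have "((a + b) / 2)\<^sup>2 = a * b + ((a - b) / 2)\<^sup>2"
    by (simp add: power2_eq_square field_simps)
  ultimately have *: "a * b + ((a - b) / 2)\<^sup>2 \<le> c\<^sup>2" by simp
  have eq: "ln a + ln b = ln (a * b)" "2 * ln c = ln (c\<^sup>2)"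
    using assms c by (simp_all add: ln_mult ln_realpow)
  have "a * b \<le> c\<^sup>2"
    using * zero_le_power2[of "(a - b) / 2"] by linarith
  hence "ln (a * b) \<le> ln (c\<^sup>2)"
    using assms by (intro ln_mono) auto
  thus "(ln a + ln b) / 2 \<le> ln c" unfolding eq(2)[symmetric] eq(1)[symmetric] by simp
  assume "a \<noteq> b"
  hence "0 < ((a - b) / 2)\<^sup>2" by simp
  hence "a * b < c\<^sup>2" using * by linarith
  hence "ln (a * b) < ln (c\<^sup>2)"
    using assms c by (subst ln_less_cancel_iff) auto
  thus "(ln a + ln b) / 2 < ln c" unfolding eq(2)[symmetric] eq(1)[symmetric] by simp
qed

text \<open>The logarithm of a concave function is midpoint concave, strictly so between points where
  the values differ.\<close>

lemma ln_lift_midpoint: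
  fixes x y :: "real ^ 'd"
  assumes conc: "concave_on orthant (lift v)"
    and x: "x \<in> orthant" "x \<noteq> 0" and y: "y \<in> orthant" "y \<noteq> 0"
  shows "(ln (lift v x) + ln (lift v y)) / 2 \<le> ln (lift v ((x + y) /\<^sub>R 2))"
    and "lift v x \<noteq> lift v y \<Longrightarrow>
      (ln (lift v x) + ln (lift v y)) / 2 < ln (lift v ((x + y) /\<^sub>R 2))"
proof -
  have "(lift v x + lift v y) / 2 \<le> lift v ((x + y) /\<^sub>R 2)"
    using concave_onD[OF conc, of "1/2" x y] x y
    by (simp add: scaleR_add_right field_simps)
  from geometric_mean_le[OF lift_pos[OF x] lift_pos[OF y] this]
  show "(ln (lift v x) + ln (lift v y)) / 2 \<le> ln (lift v ((x + y) /\<^sub>R 2))"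
    and "lift v x \<noteq> lift v y \<Longrightarrow>
      (ln (lift v x) + ln (lift v y)) / 2 < ln (lift v ((x + y) /\<^sub>R 2))"
    by auto
qed

section \<open>Entropic utility\<close>

lemma entropic_cong:
  assumes "\<And>\<omega>. \<omega> \<in> space M \<Longrightarrow> Y \<omega> = Z \<omega>"
  shows "entropic M \<gamma> Y = entropic M \<gamma> Z"
  unfolding entropic_def using assms by (auto cong: Bochner_Integration.integral_cong)

context prob_space
begin

lemma expectation_exp_pos:
  fixes Z :: "'a \<Rightarrow> real"
  assumes "integrable M (\<lambda>\<omega>. exp (Z \<omega>))"
  shows "0 < expectation (\<lambda>\<omega>. exp (Z \<omega>))"
  using expectation_greater[OF assms, of 0] by simp

text \<open>Integrability of whichever random variable enters the definition of the entropic utility;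
  without it the Bochner integral takes its default value \<open>0\<close>.\<close>

definition entropic_integrable :: "real \<Rightarrow> ('a \<Rightarrow> real) \<Rightarrow> bool" where
  "entropic_integrable \<gamma> Z \<longleftrightarrow>
     (if \<gamma> = 0 then integrable M Z else integrable M (\<lambda>\<omega>. exp (\<gamma> * Z \<omega>)))"

lemma entropic_add_const:
  assumes "entropic_integrable \<gamma> Z"
  shows "entropic M \<gamma> (\<lambda>\<omega>. a + Z \<omega>) = a + entropic M \<gamma> Z"
proof (cases "\<gamma> = 0")
  case True
  thus ?thesis using assms by (simp add: entropic_def entropic_integrable_def prob_space)
next
  case False
  have int: "integrable M (\<lambda>\<omega>. exp (\<gamma> * Z \<omega>))"
    using assms False by (simp add: entropic_integrable_def)
  show ?thesis
    using False expectation_exp_pos[OF int]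
    by (simp add: entropic_def distrib_left exp_add ln_mult)
qed

text \<open>\<open>C\<close> minus the mean of \<open>A\<close> and \<open>B\<close> is nonnegative with expectation at most zero, so
  it vanishes almost surely; it is positive wherever \<open>A\<close> and \<open>B\<close> differ.\<close>

lemma AE_eq_if_expectation_midpoint_le:
  fixes A B C :: "'a \<Rightarrow> real"
  assumes int: "integrable M A" "integrable M B" "integrable M C"
    and mid: "\<And>\<omega>. \<omega> \<in> space M \<Longrightarrow> (A \<omega> + B \<omega>) / 2 \<le> C \<omega>"
    and strict: "\<And>\<omega>. \<omega> \<in> space M \<Longrightarrow> A \<omega> \<noteq> B \<omega> \<Longrightarrow> (A \<omega> + B \<omega>) / 2 < C \<omega>"
    and le: "expectation C \<le> expectation A" "expectation C \<le> expectation B"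
  shows "AE \<omega> in M. A \<omega> = B \<omega>"
proof -
  define D where "D \<omega> = C \<omega> - (A \<omega> + B \<omega>) / 2" for \<omega>
  have D: "integrable M D" unfolding D_def using int by simp
  have nonneg: "AE \<omega> in M. 0 \<le> D \<omega>"
    using mid by (auto simp: D_def intro!: AE_I2)
  have "expectation D = expectation C - (expectation A + expectation B) / 2"
    unfolding D_def using int by simp
  hence "expectation D \<le> 0" using le by simp
  moreover have "0 \<le> expectation D"
    by (rule integral_nonneg_AE[OF nonneg])
  ultimately have "AE \<omega> in M. D \<omega> = 0"
    using integral_nonneg_eq_0_iff_AE[OF D nonneg] by simp
  thus ?thesis
    by (rule AE_mp) (use strict in \<open>auto simp: D_def intro!: AE_I2 dest!: strict\<close>)
qed

text \<open>For \<open>\<gamma> < 0\<close>, the entropic utility is an increasing function of the expectation of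
  \<open>u(Z) = - exp (\<gamma> Z)\<close>, and \<open>u\<close> is increasing and strictly concave. Hence
  \<open>u(C)\<close> is at least the mean of \<open>u(A)\<close> and \<open>u(B)\<close>, strictly so where these differ, which reduces
  the claim to plain expectations.\<close>

lemma AE_eq_if_entropic_midpoint_le:
  fixes A B C :: "'a \<Rightarrow> real"
  assumes "\<gamma> \<le> 0"
    and int: "entropic_integrable \<gamma> A" "entropic_integrable \<gamma> B" "entropic_integrable \<gamma> C"
    and mid: "\<And>\<omega>. \<omega> \<in> space M \<Longrightarrow> (A \<omega> + B \<omega>) / 2 \<le> C \<omega>"
    and strict: "\<And>\<omega>. \<omega> \<in> space M \<Longrightarrow> A \<omega> \<noteq> B \<omega> \<Longrightarrow> (A \<omega> + B \<omega>) / 2 < C \<omega>"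
    and le: "entropic M \<gamma> C \<le> entropic M \<gamma> A" "entropic M \<gamma> C \<le> entropic M \<gamma> B"
  shows "AE \<omega> in M. A \<omega> = B \<omega>"
proof (cases "\<gamma> = 0")
  case True
  show ?thesis
    using int mid strict le True
    by (intro AE_eq_if_expectation_midpoint_le[of A B C])
       (auto simp: entropic_integrable_def entropic_def)
next
  case False
  hence \<gamma>: "\<gamma> < 0" using assms(1) by simp
  define u where "u Z \<omega> = - exp (\<gamma> * Z \<omega>)" for Z and \<omega> :: 'a
  have exp_int: "integrable M (\<lambda>\<omega>. exp (\<gamma> * A \<omega>))" "integrable M (\<lambda>\<omega>. exp (\<gamma> * B \<omega>))"
      "integrable M (\<lambda>\<omega>. exp (\<gamma> * C \<omega>))"
    using int False by (auto simp: entropic_integrable_def)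
  have ent_le: "expectation (u Y) \<le> expectation (u Z)"
    if "integrable M (\<lambda>\<omega>. exp (\<gamma> * Y \<omega>))" "integrable M (\<lambda>\<omega>. exp (\<gamma> * Z \<omega>))"
      "entropic M \<gamma> Y \<le> entropic M \<gamma> Z" for Y Z
  proof -
    have "ln (expectation (\<lambda>\<omega>. exp (\<gamma> * Z \<omega>))) \<le> ln (expectation (\<lambda>\<omega>. exp (\<gamma> * Y \<omega>)))"
      using that(3) \<gamma> by (simp add: entropic_def divide_le_cancel)
    thus ?thesis
      using expectation_exp_pos[OF that(1)] expectation_exp_pos[OF that(2)]
      by (simp add: u_def[abs_def])
  qed
  have mid_u: "(u A \<omega> + u B \<omega>) / 2 \<le> u C \<omega>"
    "A \<omega> \<noteq> B \<omega> \<Longrightarrow> (u A \<omega> + u B \<omega>) / 2 < u C \<omega>" if \<omega>: "\<omega> \<in> space M" for \<omega>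
  proof -
    let ?a = "exp (\<gamma> * A \<omega>)" and ?b = "exp (\<gamma> * B \<omega>)"
    have gm: "\<gamma> * ((A \<omega> + B \<omega>) / 2) \<le> ln ((?a + ?b) / 2)"
      "A \<omega> \<noteq> B \<omega> \<Longrightarrow> \<gamma> * ((A \<omega> + B \<omega>) / 2) < ln ((?a + ?b) / 2)"
      using geometric_mean_le[of ?a ?b "(?a + ?b) / 2"] \<gamma> by (simp_all add: distrib_left)
    have "\<gamma> * C \<omega> \<le> \<gamma> * ((A \<omega> + B \<omega>) / 2)"
      using mid[OF \<omega>] \<gamma> by (intro mult_left_mono_neg) auto
    moreover have pos: "0 < (?a + ?b) / 2" by (simp add: add_pos_pos)
    ultimately show "(u A \<omega> + u B \<omega>) / 2 \<le> u C \<omega>"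
      and "A \<omega> \<noteq> B \<omega> \<Longrightarrow> (u A \<omega> + u B \<omega>) / 2 < u C \<omega>"
      using gm ln_ge_iff[OF pos, of "\<gamma> * C \<omega>"] ln_le_cancel_iff[OF pos, of "exp (\<gamma> * C \<omega>)"]
      by (auto simp: u_def)
  qed
  have "AE \<omega> in M. u A \<omega> = u B \<omega>"
  proof (rule AE_eq_if_expectation_midpoint_le[of _ _ "u C"])
    show "integrable M (u A)" "integrable M (u B)" "integrable M (u C)"
      unfolding u_def using exp_int by auto
    show "expectation (u C) \<le> expectation (u A)" "expectation (u C) \<le> expectation (u B)"
      using ent_le exp_int le by auto
  qed (use mid_u in \<open>auto simp: u_def\<close>)
  thus ?thesis using False by (simp add: u_def)
qed

lemma entropic_integrable_between:
  assumes "\<gamma> \<le> 0" and [measurable]: "Z \<in> borel_measurable M"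
    and bd: "\<And>\<omega>. \<omega> \<in> space M \<Longrightarrow> lo \<omega> \<le> Z \<omega> \<and> Z \<omega> \<le> hi \<omega>"
    and int: "integrable M lo" "integrable M hi" "integrable M (\<lambda>\<omega>. exp (\<gamma> * lo \<omega>))"
  shows "entropic_integrable \<gamma> Z"
proof -
  have "integrable M Z"
  proof (rule Bochner_Integration.integrable_bound[of _ "\<lambda>\<omega>. \<bar>lo \<omega>\<bar> + \<bar>hi \<omega>\<bar>"])
    show "AE \<omega> in M. norm (Z \<omega>) \<le> norm (\<bar>lo \<omega>\<bar> + \<bar>hi \<omega>\<bar>)"
      using bd by (intro AE_I2) force
  qed (use int in auto)
  moreover have "integrable M (\<lambda>\<omega>. exp (\<gamma> * Z \<omega>))"
  proof (rule Bochner_Integration.integrable_bound[OF int(3)])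
    show "AE \<omega> in M. norm (exp (\<gamma> * Z \<omega>)) \<le> norm (exp (\<gamma> * lo \<omega>))"
      using bd assms(1) by (intro AE_I2) (simp add: mult_left_mono_neg)
  qed auto
  ultimately show ?thesis by (simp add: entropic_integrable_def)
qed

text \<open>Dominated convergence: \<open>\<bar>lo\<bar> + \<bar>hi\<bar>\<close> dominates for \<open>\<gamma> = 0\<close> and, the
  exponential being decreasing in \<open>Z\<close>, \<open>exp (\<gamma> lo)\<close> dominates for \<open>\<gamma> < 0\<close>.\<close>

lemma continuous_on_entropic:
  fixes Z :: "'b :: {first_countable_topology, t2_space} \<Rightarrow> 'a \<Rightarrow> real"
  assumes "\<gamma> \<le> 0" and meas: "\<And>x. x \<in> A \<Longrightarrow> Z x \<in> borel_measurable M"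
    and bd: "\<And>x \<omega>. x \<in> A \<Longrightarrow> \<omega> \<in> space M \<Longrightarrow> lo \<omega> \<le> Z x \<omega> \<and> Z x \<omega> \<le> hi \<omega>"
    and cont: "\<And>\<omega>. \<omega> \<in> space M \<Longrightarrow> continuous_on A (\<lambda>x. Z x \<omega>)"
    and int: "integrable M lo" "integrable M hi" "integrable M (\<lambda>\<omega>. exp (\<gamma> * lo \<omega>))"
  shows "continuous_on A (\<lambda>x. entropic M \<gamma> (Z x))"
proof (rule continuous_on_sequentiallyI)
  fix x a assume x: "\<forall>n. x n \<in> A" and a: "a \<in> A" and lim: "x \<longlonglongrightarrow> a"
  have Zlim: "(\<lambda>n. Z (x n) \<omega>) \<longlonglongrightarrow> Z a \<omega>" if "\<omega> \<in> space M" for \<omega>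
    by (rule continuous_on_tendsto_compose[OF cont[OF that] lim a]) (use x in auto)
  have [measurable]: "Z a \<in> borel_measurable M" "\<And>n. Z (x n) \<in> borel_measurable M"
    using meas a x by auto
  show "(\<lambda>n. entropic M \<gamma> (Z (x n))) \<longlonglongrightarrow> entropic M \<gamma> (Z a)"
  proof (cases "\<gamma> = 0")
    case True
    have "(\<lambda>n. expectation (Z (x n))) \<longlonglongrightarrow> expectation (Z a)"
    proof (rule integral_dominated_convergence[where w = "\<lambda>\<omega>. \<bar>lo \<omega>\<bar> + \<bar>hi \<omega>\<bar>"])
      show "AE \<omega> in M. norm (Z (x n) \<omega>) \<le> \<bar>lo \<omega>\<bar> + \<bar>hi \<omega>\<bar>" for n
        using bd x by (intro AE_I2) (smt (verit) real_norm_def)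
    qed (use int Zlim in auto)
    thus ?thesis using True by (simp add: entropic_def)
  next
    case False
    have "(\<lambda>n. expectation (\<lambda>\<omega>. exp (\<gamma> * Z (x n) \<omega>))) \<longlonglongrightarrow> expectation (\<lambda>\<omega>. exp (\<gamma> * Z a \<omega>))"
    proof (rule integral_dominated_convergence[where w = "\<lambda>\<omega>. exp (\<gamma> * lo \<omega>)"])
      show "AE \<omega> in M. norm (exp (\<gamma> * Z (x n) \<omega>)) \<le> exp (\<gamma> * lo \<omega>)" for n
        using bd x assms(1) by (intro AE_I2) (simp add: mult_left_mono_neg)
      show "AE \<omega> in M. (\<lambda>n. exp (\<gamma> * Z (x n) \<omega>)) \<longlonglongrightarrow> exp (\<gamma> * Z a \<omega>)"
        using Zlim by (intro AE_I2 tendsto_intros)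
    qed (use int in auto)
    moreover have "0 < expectation (\<lambda>\<omega>. exp (\<gamma> * Z a \<omega>))"
    proof (rule expectation_exp_pos, rule Bochner_Integration.integrable_bound[OF int(3)])
      show "AE \<omega> in M. norm (exp (\<gamma> * Z a \<omega>)) \<le> norm (exp (\<gamma> * lo \<omega>))"
        using bd a assms(1) by (intro AE_I2) (simp add: mult_left_mono_neg)
    qed auto
    ultimately show ?thesis
      using False unfolding entropic_def by (auto intro!: tendsto_intros)
  qed
qed

end

section \<open>Evaluating a right-continuous process at an independent time\<close>

text \<open>The first point of the grid of mesh \<open>1 / (n + 1)\<close> strictly to the right of \<open>t\<close>. It has
  to be strict, since right-continuity is a limit along \<open>at_right t\<close>.\<close>

lemma right_approximation_tendsto:
  fixes t :: real
  assumes t: "0 \<le> t"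
  shows "filterlim (\<lambda>n. (real (nat \<lfloor>real (Suc n) * t\<rfloor>) + 1) / real (Suc n)) (at_right t) sequentially"
    (is "filterlim ?s _ _")
proof -
  have gt: "t < ?s n" and le: "?s n \<le> t + inverse (real (Suc n))" for n
  proof -
    have "real (nat \<lfloor>real (Suc n) * t\<rfloor>) = of_int \<lfloor>real (Suc n) * t\<rfloor>"
      using t by (intro of_nat_nat) simp
    hence "real (Suc n) * t < real (nat \<lfloor>real (Suc n) * t\<rfloor>) + 1"
      "real (nat \<lfloor>real (Suc n) * t\<rfloor>) \<le> real (Suc n) * t"
      by linarith+
    moreover have "t < (k + 1) / m" "(k + 1) / m \<le> t + inverse m"
      if "0 < m" "m * t < k + 1" "k \<le> m * t" for m k :: real
      using that by (simp_all add: field_simps)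
    ultimately show "t < ?s n" "?s n \<le> t + inverse (real (Suc n))"
      using of_nat_0_less_iff[of "Suc n"] by blast+
  qed
  have "(\<lambda>n. t + inverse (real (Suc n))) \<longlonglongrightarrow> t + 0"
    by (intro tendsto_intros LIMSEQ_inverse_real_of_nat)
  hence "?s \<longlonglongrightarrow> t"
    using gt le by (intro tendsto_sandwich[of "\<lambda>_. t" ?s sequentially "\<lambda>n. t + inverse (real (Suc n))"])
      (auto intro!: always_eventually less_imp_le)
  thus ?thesis
    using gt less_imp_neq[OF gt, symmetric] unfolding filterlim_at
    by (intro conjI always_eventually allI) simp_all
qed

text \<open>Evaluating the process at the next grid point uses only countably many times and is
  therefore jointly measurable; by right-continuity these approximations converge. Truncating the
  time at zero keeps the statement on the whole real line.\<close>

lemma right_continuous_jointly_measurable: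
  fixes X :: "real \<Rightarrow> 'a \<Rightarrow> 'b :: metric_space"
  assumes meas: "\<And>t. 0 \<le> t \<Longrightarrow> X t \<in> borel_measurable N"
    and rcont: "\<And>\<omega> t. \<omega> \<in> space N \<Longrightarrow> 0 \<le> t \<Longrightarrow> ((\<lambda>u. X u \<omega>) \<longlongrightarrow> X t \<omega>) (at_right t)"
  shows "(\<lambda>z. X (max 0 (fst z)) (snd z)) \<in> borel_measurable (borel \<Otimes>\<^sub>M N)"
proof (rule borel_measurable_LIMSEQ_metric)
  let ?k = "\<lambda>n t. nat \<lfloor>real (Suc n) * max 0 t\<rfloor>"
  fix n
  show "(\<lambda>z. X ((real (?k n (fst z)) + 1) / real (Suc n)) (snd z)) \<in> borel_measurable (borel \<Otimes>\<^sub>M N)"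
  proof (rule measurable_compose_countable[where f = "\<lambda>k z. X ((real k + 1) / real (Suc n)) (snd z)"])
    show "(\<lambda>z. X ((real k + 1) / real (Suc n)) (snd z)) \<in> borel_measurable (borel \<Otimes>\<^sub>M N)" for k
      by (rule measurable_compose[OF measurable_snd meas]) simp
    show "(\<lambda>z. ?k n (fst z)) \<in> measurable (borel \<Otimes>\<^sub>M N) (count_space UNIV)"
      by measurable
  qed
next
  fix z :: "real \<times> 'a"
  assume "z \<in> space (borel \<Otimes>\<^sub>M N)"
  hence z: "snd z \<in> space N" by (auto simp: space_pair_measure)
  show "(\<lambda>n. X ((real (nat \<lfloor>real (Suc n) * max 0 (fst z)\<rfloor>) + 1) / real (Suc n)) (snd z))
      \<longlonglongrightarrow> X (max 0 (fst z)) (snd z)"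
    by (rule filterlim_compose[OF rcont[OF z] right_approximation_tendsto]) simp_all
qed

context prob_space
begin

lemma measurable_at_independent_time:
  fixes X :: "real \<Rightarrow> 'a \<Rightarrow> 'b :: metric_space"
  assumes \<tau>: "\<tau> \<in> borel_measurable M" and id: "(\<lambda>\<omega>. \<omega>) \<in> measurable M N"
    and pos: "\<And>\<omega>. \<omega> \<in> space M \<Longrightarrow> 0 \<le> \<tau> \<omega>"
    and joint: "(\<lambda>z. X (max 0 (fst z)) (snd z)) \<in> borel_measurable (borel \<Otimes>\<^sub>M N)"
  shows "(\<lambda>\<omega>. X (\<tau> \<omega>) \<omega>) \<in> borel_measurable M"
proof -
  have "(\<lambda>\<omega>. X (max 0 (\<tau> \<omega>)) \<omega>) \<in> borel_measurable M"
    using measurable_compose[OF measurable_Pair[OF \<tau> id] joint] by simp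
  also have "?this \<longleftrightarrow> ?thesis"
    using pos by (intro measurable_cong) simp
  finally show ?thesis .
qed

text \<open>Independence makes the law of \<open>(\<tau> \<omega>, \<omega>)\<close> a product measure. If the event were null, Fubini's
  theorem would make \<open>X t \<in> A\<close> a null event for almost every \<open>t\<close> under the law of \<open>\<tau>\<close>, hence for
  at least one \<open>t > 0\<close>. Here \<open>N\<close> is a \<open>\<sigma>\<close>-algebra carrying the process.\<close>

lemma prob_at_independent_time_pos:
  fixes X :: "real \<Rightarrow> 'a \<Rightarrow> 'b :: metric_space"
  assumes \<tau>[measurable]: "\<tau> \<in> borel_measurable M"
    and id[measurable]: "(\<lambda>\<omega>. \<omega>) \<in> measurable M N" and space: "space N = space M"
    and indep: "\<And>I B. I \<in> sets borel \<Longrightarrow> B \<in> sets N \<Longrightarrow>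
      prob ((\<tau> -` I \<inter> space M) \<inter> B) = prob (\<tau> -` I \<inter> space M) * prob B"
    and pos: "\<And>\<omega>. \<omega> \<in> space M \<Longrightarrow> 0 < \<tau> \<omega>"
    and joint: "(\<lambda>z. X (max 0 (fst z)) (snd z)) \<in> borel_measurable (borel \<Otimes>\<^sub>M N)"
    and A: "A \<in> sets borel"
    and hit: "\<And>t. 0 < t \<Longrightarrow> 0 < prob {\<omega> \<in> space M. X t \<omega> \<in> A}"
  shows "0 < prob {\<omega> \<in> space M. X (\<tau> \<omega>) \<omega> \<in> A}"
proof (rule ccontr)
  note joint[measurable] A[measurable]
  have [measurable]: "(\<lambda>\<omega>. X (max 0 (\<tau> \<omega>)) \<omega>) \<in> borel_measurable M"
    using measurable_compose[OF measurable_Pair[OF \<tau> id] joint] by simp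
  let ?Y = "\<lambda>z. X (max 0 (fst z)) (snd z)"
  interpret T: prob_space "distr M borel \<tau>" by (rule prob_space_distr) simp
  interpret P: prob_space "distr M N (\<lambda>\<omega>. \<omega>)" by (rule prob_space_distr) simp
  interpret TP: pair_sigma_finite "distr M borel \<tau>" "distr M N (\<lambda>\<omega>. \<omega>)" ..
  have pair: "distr M borel \<tau> \<Otimes>\<^sub>M distr M N (\<lambda>\<omega>. \<omega>) = distr M (borel \<Otimes>\<^sub>M N) (\<lambda>\<omega>. (\<tau> \<omega>, \<omega>))"
  proof (rule pair_measure_eqI)
    show "sigma_finite_measure (distr M borel \<tau>)" "sigma_finite_measure (distr M N (\<lambda>\<omega>. \<omega>))"
      by (rule T.sigma_finite_measure_axioms P.sigma_finite_measure_axioms)+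
    show "sets (distr M borel \<tau> \<Otimes>\<^sub>M distr M N (\<lambda>\<omega>. \<omega>)) = sets (distr M (borel \<Otimes>\<^sub>M N) (\<lambda>\<omega>. (\<tau> \<omega>, \<omega>)))"
      by (simp cong: sets_pair_measure_cong)
    fix I B assume "I \<in> sets (distr M borel \<tau>)" "B \<in> sets (distr M N (\<lambda>\<omega>. \<omega>))"
    hence I[measurable]: "I \<in> sets borel" and B[measurable]: "B \<in> sets N" by simp_all
    have B': "B \<inter> space M = B" using sets.sets_into_space[OF B] space by auto
    have "(\<lambda>\<omega>. (\<tau> \<omega>, \<omega>)) -` (I \<times> B) \<inter> space M = (\<tau> -` I \<inter> space M) \<inter> B"
      using B' by auto
    thus "emeasure (distr M borel \<tau>) I * emeasure (distr M N (\<lambda>\<omega>. \<omega>)) B =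
        emeasure (distr M (borel \<Otimes>\<^sub>M N) (\<lambda>\<omega>. (\<tau> \<omega>, \<omega>))) (I \<times> B)"
      using indep[OF I B] B'
      by (simp add: emeasure_distr emeasure_eq_measure ennreal_mult'')
  qed
  assume "\<not> 0 < prob {\<omega> \<in> space M. X (\<tau> \<omega>) \<omega> \<in> A}"
  hence "prob {\<omega> \<in> space M. X (\<tau> \<omega>) \<omega> \<in> A} = 0"
    using measure_nonneg[of M] by (simp add: less_le)
  moreover have "{\<omega> \<in> space M. X (\<tau> \<omega>) \<omega> \<in> A} = {\<omega> \<in> space M. ?Y (\<tau> \<omega>, \<omega>) \<in> A}"
    using pos by (auto simp: less_imp_le)
  ultimately have "prob {\<omega> \<in> space M. ?Y (\<tau> \<omega>, \<omega>) \<in> A} = 0" by simp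
  hence "AE \<omega> in M. ?Y (\<tau> \<omega>, \<omega>) \<notin> A"
    by (subst AE_iff_measurable[OF _ refl]) (auto simp: emeasure_eq_measure)
  hence "AE z in distr M (borel \<Otimes>\<^sub>M N) (\<lambda>\<omega>. (\<tau> \<omega>, \<omega>)). ?Y z \<notin> A"
    by (subst AE_distr_iff) auto
  hence "AE z in distr M borel \<tau> \<Otimes>\<^sub>M distr M N (\<lambda>\<omega>. \<omega>). ?Y z \<notin> A"
    by (simp only: pair)
  hence "AE t in distr M borel \<tau>. AE \<omega> in distr M N (\<lambda>\<omega>. \<omega>). ?Y (t, \<omega>) \<notin> A"
    by (rule TP.AE_pair)
  moreover have "AE t in distr M borel \<tau>. 0 < t"
    using pos by (subst AE_distr_iff) auto
  ultimately have "AE t in distr M borel \<tau>. False"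
  proof eventually_elim
    case (elim t)
    have X[measurable]: "X t \<in> borel_measurable N"
      using measurable_compose[OF measurable_Pair1'[of t borel N] joint] elim(2) by simp
    have "AE \<omega> in M. X t \<omega> \<notin> A"
      using elim by (subst (asm) AE_distr_iff) auto
    moreover have "X t \<in> borel_measurable M"
      by (rule measurable_compose[OF id X])
    ultimately have "prob {\<omega> \<in> space M. X t \<omega> \<in> A} = 0"
      by (subst (asm) AE_iff_measurable[OF _ refl]) (auto simp: emeasure_eq_measure)
    thus ?case using hit[OF elim(2)] by simp
  qed
  thus False by (simp add: T.AE_False)
qed

end

section \<open>Transaction costs\<close>

lemma cost_midpoint:
  "cost c h ((x + y) /\<^sub>R 2) \<le> (cost c h x + cost c h y) / 2"
proof -
  have "max (c $ i * ((x + y) /\<^sub>R 2) $ i) (- (h $ i) * ((x + y) /\<^sub>R 2) $ i)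
    \<le> (max (c $ i * x $ i) (- (h $ i) * x $ i) + max (c $ i * y $ i) (- (h $ i) * y $ i)) / 2" for i
  proof -
    have "c $ i * ((x + y) /\<^sub>R 2) $ i = (c $ i * x $ i + c $ i * y $ i) / 2"
      "- (h $ i) * ((x + y) /\<^sub>R 2) $ i = (- (h $ i) * x $ i + - (h $ i) * y $ i) / 2"
      by (simp_all add: field_simps)
    moreover have "max ((a + b) / 2) ((a' + b') / 2) \<le> (max a a' + max b b') / 2"
      for a b a' b' :: real
      by (simp add: max_def)
    ultimately show ?thesis by (simp only:)
  qed
  thus ?thesis
    unfolding cost_def sum.distrib[symmetric] sum_divide_distrib by (rule sum_mono)
qed

locale proportional_costs =
  fixes c h :: "real ^ 'd"
  assumes c: "\<forall>i. 0 \<le> c $ i \<and> c $ i < 1" and h: "\<forall>i. 0 \<le> h $ i \<and> h $ i < 1"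
begin

lemma cost_nonneg: "0 \<le> cost c h x"
proof -
  have "0 \<le> max (c $ i * x $ i) (- (h $ i) * x $ i)" for i
    using c h by (cases "0 \<le> x $ i") (auto simp: le_max_iff_disj mult_nonneg_nonpos)
  thus ?thesis unfolding cost_def by (intro sum_nonneg) auto
qed

text \<open>Selling everything does not consume all wealth, since every proportional selling cost is
  below one. This excludes \<open>0\<close> as a solution of the shrinkage equation.\<close>

lemma liquidation_cost_less:
  assumes "\<pi> \<in> prob_simplex"
  shows "cost c h (- \<pi>) < 1"
proof -
  have \<pi>: "\<And>i. 0 \<le> \<pi> $ i" "(\<Sum>i\<in>UNIV. \<pi> $ i) = 1"
    using assms by (auto simp: prob_simplex_def inner_one_eq_sum)
  obtain j where j: "0 < \<pi> $ j"
    using \<pi> by (metis order_le_less sum.neutral zero_neq_one)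
  have "max (c $ i * (- \<pi>) $ i) (- (h $ i) * (- \<pi>) $ i) \<le> \<pi> $ i" for i
  proof -
    have "0 \<le> c $ i * \<pi> $ i" "h $ i * \<pi> $ i \<le> \<pi> $ i"
      using c h \<pi> by (auto intro!: mult_left_le_one_le simp: less_imp_le)
    thus ?thesis using \<pi>(1)[of i] by auto
  qed
  moreover have "max (c $ j * (- \<pi>) $ j) (- (h $ j) * (- \<pi>) $ j) < \<pi> $ j"
  proof -
    have "0 \<le> c $ j * \<pi> $ j" "h $ j * \<pi> $ j < \<pi> $ j"
      using c h j by auto
    thus ?thesis using j by auto
  qed
  ultimately show ?thesis
    unfolding cost_def \<pi>(2)[symmetric] by (intro sum_strict_mono_ex1) auto
qed

lemma shrink_props:
  assumes "\<pi> \<in> prob_simplex" "q \<in> prob_simplex"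
  shows "0 < shrink c h \<pi> q" "shrink c h \<pi> q + cost c h (shrink c h \<pi> q *\<^sub>R q - \<pi>) = 1"
  using theI'[OF shrink_ex1[OF c h assms]] by (auto simp: shrink_def)

lemma shrink_eqI:
  assumes "\<pi> \<in> prob_simplex" "q \<in> prob_simplex" "0 < w" "w + cost c h (w *\<^sub>R q - \<pi>) = 1"
  shows "shrink c h \<pi> q = w"
  using shrink_ex1[OF c h assms(1,2)] assms(3,4) by (auto simp: shrink_def intro!: the1_equality)

text \<open>An affordable level of wealth lies below the shrinkage factor: since wealth \<open>1\<close> is never
  strictly affordable, the intermediate value theorem gives a solution of the shrinkage equation
  at or above \<open>w\<close>, and there is only one solution.\<close>

lemma le_shrinkI:
  assumes \<pi>: "\<pi> \<in> prob_simplex" and q: "q \<in> prob_simplex"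
    and w: "0 \<le> w" "w + cost c h (w *\<^sub>R q - \<pi>) \<le> 1"
  shows "w \<le> shrink c h \<pi> q"
proof -
  define f where "f u = u + cost c h (u *\<^sub>R q - \<pi>)" for u
  have "continuous_on {w..1} f"
    unfolding f_def cost_def by (intro continuous_intros)
  moreover have "1 \<le> f 1" "f w \<le> 1" "w \<le> 1"
    using w cost_nonneg[of "1 *\<^sub>R q - \<pi>"] cost_nonneg[of "w *\<^sub>R q - \<pi>"] by (simp_all add: f_def)
  ultimately obtain u where u: "w \<le> u" "f u = 1"
    using IVT'[of f w 1 1] by auto
  have "u \<noteq> 0"
    using u(2) liquidation_cost_less[OF \<pi>] by (auto simp: f_def)
  hence "0 < u" using u w by simp
  thus ?thesis
    using shrink_eqI[OF \<pi> q, of u] u by (simp add: f_def)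
qed

text \<open>The factor takes values in the compact interval \<open>[0, 1]\<close>, and its graph is cut out by the
  shrinkage equation, which is continuous in all variables. Thus the closed graph theorem
  applies. The closed interval adds no spurious points, because \<open>0\<close> never solves the equation.\<close>

lemma continuous_on_shrink:
  "continuous_on (prob_simplex \<times> prob_simplex) (\<lambda>(\<pi>, q). shrink c h \<pi> q)"
proof (rule continuous_from_closed_graph)
  show "compact {0..1 :: real}" by simp
  have le1: "shrink c h \<pi> q \<le> 1" if "\<pi> \<in> prob_simplex" "q \<in> prob_simplex" for \<pi> q
    using shrink_props(2)[OF that] cost_nonneg[of "shrink c h \<pi> q *\<^sub>R q - \<pi>"] by linarith
  show "(\<lambda>(\<pi>, q). shrink c h \<pi> q) \<in> prob_simplex \<times> prob_simplex \<rightarrow> {0..1}"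
    using shrink_props(1) le1 by (force simp: less_imp_le)
  have graph: "(\<lambda>x. (x, case x of (\<pi>, q) \<Rightarrow> shrink c h \<pi> q)) ` (prob_simplex \<times> prob_simplex) =
      ((prob_simplex \<times> prob_simplex) \<times> {0..1}) \<inter>
      {z. snd z + cost c h (snd z *\<^sub>R snd (fst z) - fst (fst z)) = 1}" (is "?L = ?R")
  proof (intro set_eqI iffI)
    fix z assume "z \<in> ?L"
    thus "z \<in> ?R" using shrink_props le1 by (auto simp: less_imp_le)
  next
    fix z assume z: "z \<in> ?R"
    obtain \<pi> q w where zeq: "z = ((\<pi>, q), w)" by (metis surj_pair)
    have "w \<noteq> 0" using z liquidation_cost_less[of \<pi>] by (auto simp: zeq)
    hence "shrink c h \<pi> q = w" using z by (intro shrink_eqI) (auto simp: zeq)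
    thus "z \<in> ?L" using z by (force simp: zeq)
  qed
  show "closed ((\<lambda>x. (x, case x of (\<pi>, q) \<Rightarrow> shrink c h \<pi> q)) ` (prob_simplex \<times> prob_simplex))"
    unfolding graph cost_def
    by (intro closed_Int closed_Times compact_imp_closed[OF compact_prob_simplex] closed_Collect_eq
        continuous_intros closed_atLeastAtMost)
qed

end

section \<open>The one-period problem\<close>

text \<open>A special case of Berge's maximum theorem: the graph of \<open>g\<close> is the set of all \<open>(x, z)\<close>
  with \<open>f x y \<le> f x z\<close> for every \<open>y \<in> B\<close>, an intersection of closed sets.\<close>

lemma continuous_on_unique_argmax:
  fixes f :: "'a::euclidean_space \<Rightarrow> 'b::euclidean_space \<Rightarrow> real"
  assumes A: "compact A" and B: "compact B"
    and f: "continuous_on (A \<times> B) (\<lambda>(x, y). f x y)"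
    and g: "\<And>x. x \<in> A \<Longrightarrow> g x \<in> B" "\<And>x y. x \<in> A \<Longrightarrow> y \<in> B \<Longrightarrow> f x y \<le> f x (g x)"
    and unique: "\<And>x z. x \<in> A \<Longrightarrow> z \<in> B \<Longrightarrow> \<forall>y\<in>B. f x y \<le> f x z \<Longrightarrow> z = g x"
  shows "continuous_on A g"
proof (rule continuous_from_closed_graph[OF B])
  show "g \<in> A \<rightarrow> B" using g by auto
  have AB: "closed (A \<times> B)" by (intro closed_Times compact_imp_closed A B)
  have "(\<lambda>x. (x, g x)) ` A = A \<times> B \<inter> (\<Inter>y\<in>B. {z \<in> A \<times> B. f (fst z) y \<le> f (fst z) (snd z)})"
    (is "?L = ?R")
  proof (intro set_eqI iffI)
    fix z assume "z \<in> ?R"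
    thus "z \<in> ?L" using unique[of "fst z" "snd z"] by (cases z) auto
  qed (use g in auto)
  moreover have "closed {z \<in> A \<times> B. f (fst z) y \<le> f (fst z) (snd z)}" if y: "y \<in> B" for y
  proof (rule continuous_on_closed_Collect_le[OF _ _ AB])
    show "continuous_on (A \<times> B) (\<lambda>z. f (fst z) y)"
      using continuous_on_compose2[OF f, of "A \<times> B" "\<lambda>z. (fst z, y)"] y
      by (force intro!: continuous_intros)
    show "continuous_on (A \<times> B) (\<lambda>z. f (fst z) (snd z))"
      using f by (simp add: case_prod_beta')
  qed
  ultimately show "closed ((\<lambda>x. (x, g x)) ` A)"
    using AB by (auto intro!: closed_Int closed_INT)
qed

text \<open>What the optimization needs to know about the returns: bounds that make every utility below
  finite, and the separation property that yields uniqueness.\<close>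

locale one_period_problem = prob_space M + proportional_costs c h
  for M :: "'a measure" and c h :: "real ^ 'd" +
  fixes R :: "'a \<Rightarrow> real ^ 'd" and lo hi :: "'a \<Rightarrow> real"
    and v :: "real ^ 'd \<Rightarrow> real" and \<gamma> :: real
  assumes nonpos: "\<gamma> \<le> 0"
    and R_measurable: "R \<in> borel_measurable M"
    and R_pos: "\<And>\<omega> i. \<omega> \<in> space M \<Longrightarrow> 0 < R \<omega> $ i"
    and lo_hi: "\<And>\<omega> i. \<omega> \<in> space M \<Longrightarrow> lo \<omega> \<le> ln (R \<omega> $ i) \<and> ln (R \<omega> $ i) \<le> hi \<omega>"
    and integrable: "integrable M lo" "integrable M hi" "integrable M (\<lambda>\<omega>. exp (\<gamma> * lo \<omega>))"
    and v: "continuous_on prob_simplex v" and concave: "concave_on orthant (lift v)"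
    and separating: "\<And>x y. x \<in> orthant \<Longrightarrow> y \<in> orthant \<Longrightarrow>
      AE \<omega> in M. lift v (x * R \<omega>) = lift v (y * R \<omega>) \<Longrightarrow> x = y"
begin

text \<open>The utility of holding the position \<open>x\<close>, not necessarily of total value one, until the next
  trading time.\<close>

definition util :: "real ^ 'd \<Rightarrow> real" where
  "util x = entropic M \<gamma> (\<lambda>\<omega>. ln (lift v (x * R \<omega>)))"

definition objective :: "real ^ 'd \<Rightarrow> real ^ 'd \<Rightarrow> real" where
  "objective \<pi> q = ln (shrink c h \<pi> q) + util q"

lemma R_orthant: "\<omega> \<in> space M \<Longrightarrow> R \<omega> \<in> orthant"
  using R_pos by (auto simp: orthant_def less_imp_le)

lemma lift_R_pos: "\<omega> \<in> space M \<Longrightarrow> x \<in> orthant \<Longrightarrow> x \<noteq> 0 \<Longrightarrow> 0 < lift v (x * R \<omega>)"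
  by (intro lift_pos orthant_mult R_orthant mult_pos_vec_nonzero R_pos)

lemma measurable_lift_R:
  assumes x: "x \<in> orthant"
  shows "(\<lambda>\<omega>. lift v (x * R \<omega>)) \<in> borel_measurable M"
proof -
  have "continuous_on orthant (\<lambda>y. lift v (x * y))"
    using x by (intro continuous_on_compose2[OF continuous_on_lift[OF v]] continuous_intros)
      (auto intro: orthant_mult)
  hence [measurable]: "(\<lambda>y. indicator orthant y *\<^sub>R lift v (x * y)) \<in> borel_measurable borel"
    by (intro borel_measurable_continuous_on_indicator) (simp add: closed_orthant borel_closed)
  note R_measurable[measurable]
  have "(\<lambda>\<omega>. indicator orthant (R \<omega>) *\<^sub>R lift v (x * R \<omega>)) \<in> borel_measurable M"
    by (rule measurable_compose[OF R_measurable]) measurable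
  also have "?this \<longleftrightarrow> ?thesis"
    using R_orthant by (intro measurable_cong) auto
  finally show ?thesis .
qed

text \<open>The value \<open>\<langle>q, R\<rangle>\<close> of a portfolio is an average of the returns, so its logarithm lies between
  those of the smallest and the largest return; \<open>v\<close> adds a bounded error.\<close>

lemma ln_lift_R_bounds:
  obtains K where "\<And>q \<omega>. q \<in> prob_simplex \<Longrightarrow> \<omega> \<in> space M \<Longrightarrow>
    lo \<omega> - K \<le> ln (lift v (q * R \<omega>)) \<and> ln (lift v (q * R \<omega>)) \<le> hi \<omega> + K"
proof -
  obtain K where K: "\<And>x. x \<in> prob_simplex \<Longrightarrow> \<bar>v x\<bar> \<le> K"
    using continuous_on_simplex_bounded[OF v] by blast
  show ?thesis
  proof (rule that)
    fix q :: "real ^ 'd" and \<omega> assume q: "q \<in> prob_simplex" and \<omega>: "\<omega> \<in> space M"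
    have nz: "q * R \<omega> \<noteq> 0"
      using q \<omega> by (intro mult_pos_vec_nonzero R_pos simplex_nonzero)
    have "G q (R \<omega>) \<in> prob_simplex"
      using orthant_normalize[OF orthant_mult nz] simplex_orthant[OF q] R_orthant[OF \<omega>]
      by (simp add: G_def mult_inner_one)
    hence v: "\<bar>v (G q (R \<omega>))\<bar> \<le> K" by (rule K)
    have "exp (lo \<omega>) \<le> R \<omega> $ i" "R \<omega> $ i \<le> exp (hi \<omega>)" for i
      using lo_hi[OF \<omega>, of i] R_pos[OF \<omega>, of i] by (metis exp_le_cancel_iff exp_ln)+
    hence inner: "exp (lo \<omega>) \<le> q \<bullet> R \<omega>" "q \<bullet> R \<omega> \<le> exp (hi \<omega>)"
      by (auto intro: simplex_inner_bounds[OF q])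
    hence pos: "0 < q \<bullet> R \<omega>" using exp_gt_zero less_le_trans by blast
    have "lo \<omega> \<le> ln (q \<bullet> R \<omega>)" "ln (q \<bullet> R \<omega>) \<le> hi \<omega>"
      using inner pos by (auto simp: ln_ge_iff) (metis ln_exp ln_mono)
    thus "lo \<omega> - K \<le> ln (lift v (q * R \<omega>)) \<and> ln (lift v (q * R \<omega>)) \<le> hi \<omega> + K"
      using v pos by (simp add: lift_mult_eq[OF nz] ln_mult abs_le_iff)
  qed
qed

lemma integrable_shifted_bounds:
  "integrable M (\<lambda>\<omega>. lo \<omega> - K)" "integrable M (\<lambda>\<omega>. hi \<omega> + K)"
  "integrable M (\<lambda>\<omega>. exp (\<gamma> * (lo \<omega> - K)))"
  using integrable by (simp_all add: right_diff_distrib exp_diff)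

lemma util_integrable:
  assumes x: "x \<in> orthant" "x \<noteq> 0"
  shows "entropic_integrable \<gamma> (\<lambda>\<omega>. ln (lift v (x * R \<omega>)))"
proof -
  \<comment> \<open>By homogeneity the bounds for \<open>x\<close> are those for the portfolio \<open>q\<close>, shifted by \<open>ln a\<close>.\<close>
  define a where "a = x \<bullet> 1"
  define q where "q = x /\<^sub>R a"
  have a: "0 < a" unfolding a_def by (rule orthant_inner_one_pos[OF x])
  have q: "q \<in> prob_simplex" unfolding q_def a_def by (rule orthant_normalize[OF x])
  have xq: "x = a *\<^sub>R q" using a by (simp add: q_def)
  obtain K where K: "\<And>q \<omega>. q \<in> prob_simplex \<Longrightarrow> \<omega> \<in> space M \<Longrightarrow>
      lo \<omega> - K \<le> ln (lift v (q * R \<omega>)) \<and> ln (lift v (q * R \<omega>)) \<le> hi \<omega> + K"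
    using ln_lift_R_bounds by blast
  have eq: "ln (lift v (x * R \<omega>)) = ln a + ln (lift v (q * R \<omega>))" if "\<omega> \<in> space M" for \<omega>
    using a lift_R_pos[OF that simplex_orthant[OF q] simplex_nonzero[OF q]]
    by (simp add: xq lift_scaleR ln_mult)
  show ?thesis
  proof (rule entropic_integrable_between[OF nonpos])
    show "(\<lambda>\<omega>. ln (lift v (x * R \<omega>))) \<in> borel_measurable M"
      using measurable_lift_R[OF x(1)] by measurable
    show "lo \<omega> - (K - ln a) \<le> ln (lift v (x * R \<omega>)) \<and> ln (lift v (x * R \<omega>)) \<le> hi \<omega> + (K + ln a)"
      if "\<omega> \<in> space M" for \<omega>
      using K[OF q that] eq[OF that] by auto
  qed (rule integrable_shifted_bounds)+
qed

lemma util_scaleR: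
  assumes x: "x \<in> orthant" "x \<noteq> 0" and a: "0 < a"
  shows "util (a *\<^sub>R x) = ln a + util x"
proof -
  have "util (a *\<^sub>R x) = entropic M \<gamma> (\<lambda>\<omega>. ln a + ln (lift v (x * R \<omega>)))"
    unfolding util_def
  proof (rule entropic_cong)
    fix \<omega> assume "\<omega> \<in> space M"
    from lift_R_pos[OF this x] a
    show "ln (lift v (a *\<^sub>R x * R \<omega>)) = ln a + ln (lift v (x * R \<omega>))"
      by (simp add: lift_scaleR ln_mult)
  qed
  thus ?thesis
    using entropic_add_const[OF util_integrable[OF x]] by (simp add: util_def)
qed

lemma continuous_on_util: "continuous_on prob_simplex util"
proof -
  obtain K where K: "\<And>q \<omega>. q \<in> prob_simplex \<Longrightarrow> \<omega> \<in> space M \<Longrightarrow>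
      lo \<omega> - K \<le> ln (lift v (q * R \<omega>)) \<and> ln (lift v (q * R \<omega>)) \<le> hi \<omega> + K"
    using ln_lift_R_bounds by blast
  show ?thesis
    unfolding util_def
  proof (rule continuous_on_entropic[OF nonpos _ K])
    show "(\<lambda>\<omega>. ln (lift v (q * R \<omega>))) \<in> borel_measurable M" if "q \<in> prob_simplex" for q
      using measurable_lift_R[OF simplex_orthant[OF that]] by measurable
    show "continuous_on prob_simplex (\<lambda>q. ln (lift v (q * R \<omega>)))" if \<omega>: "\<omega> \<in> space M" for \<omega>
    proof (intro continuous_on_ln continuous_on_compose2[OF continuous_on_lift[OF v]] continuous_intros)
      show "(\<lambda>q. q * R \<omega>) ` prob_simplex \<subseteq> orthant"
        using R_orthant[OF \<omega>] by (auto intro: orthant_mult simplex_orthant)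
      show "\<forall>q\<in>prob_simplex. lift v (q * R \<omega>) \<noteq> 0"
        using lift_R_pos[OF \<omega> simplex_orthant simplex_nonzero] by force
    qed
  qed (assumption | rule integrable_shifted_bounds)+
qed

lemma continuous_on_objective:
  "continuous_on (prob_simplex \<times> prob_simplex) (\<lambda>(\<pi>, q). objective \<pi> q)"
proof -
  have "continuous_on (prob_simplex \<times> prob_simplex)
      (\<lambda>z. ln (case z of (\<pi>, q) \<Rightarrow> shrink c h \<pi> q) + util (snd z))"
  proof (intro continuous_on_add continuous_on_ln continuous_on_shrink)
    show "\<forall>z\<in>prob_simplex \<times> prob_simplex. (case z of (\<pi>, q) \<Rightarrow> shrink c h \<pi> q) \<noteq> 0"
      using shrink_props(1) by force
    show "continuous_on (prob_simplex \<times> prob_simplex) (\<lambda>z. util (snd z))"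
      by (rule continuous_on_compose2[OF continuous_on_util]) (auto intro!: continuous_intros)
  qed
  thus ?thesis by (simp add: objective_def case_prod_beta')
qed

text \<open>Choosing a portfolio amounts to choosing the position that remains after paying the costs.\<close>

lemma objective_eq_util:
  assumes "\<pi> \<in> prob_simplex" "q \<in> prob_simplex"
  shows "objective \<pi> q = util (shrink c h \<pi> q *\<^sub>R q)"
  using assms shrink_props(1)[OF assms]
  by (simp add: objective_def util_scaleR simplex_orthant simplex_nonzero)

text \<open>An affordable position is dominated by trading into the portfolio it represents, because the
  shrinkage factor of that portfolio is at least the total value of the position.\<close>

lemma util_le_objective:
  assumes \<pi>: "\<pi> \<in> prob_simplex" and x: "x \<in> orthant" "x \<noteq> 0"
    and affordable: "x \<bullet> 1 + cost c h (x - \<pi>) \<le> 1"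
  shows "util x \<le> objective \<pi> (x /\<^sub>R (x \<bullet> 1))"
proof -
  define a where "a = x \<bullet> 1"
  define q where "q = x /\<^sub>R a"
  have a: "0 < a" unfolding a_def by (rule orthant_inner_one_pos[OF x])
  have q: "q \<in> prob_simplex" unfolding q_def a_def by (rule orthant_normalize[OF x])
  have xq: "x = a *\<^sub>R q" using a by (simp add: q_def)
  have "a + cost c h (a *\<^sub>R q - \<pi>) \<le> 1"
    using affordable unfolding a_def[symmetric] xq[symmetric] .
  hence "a \<le> shrink c h \<pi> q"
    using a by (intro le_shrinkI[OF \<pi> q]) simp_all
  hence "ln a + util q \<le> objective \<pi> q"
    using a by (simp add: objective_def)
  moreover have "util x = ln a + util q"
    using a q by (simp add: xq util_scaleR simplex_orthant simplex_nonzero)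
  ultimately show ?thesis by (simp add: q_def a_def)
qed

text \<open>The midpoint of the two optimal positions is affordable by convexity of the cost, so it cannot
  have larger utility than either. The equality case of the midpoint inequality and separation
  identify the positions; normalizing them identifies the portfolios.\<close>

lemma maximizer_unique:
  assumes \<pi>: "\<pi> \<in> prob_simplex"
    and p: "p \<in> prob_simplex" "\<And>q. q \<in> prob_simplex \<Longrightarrow> objective \<pi> q \<le> objective \<pi> p"
    and p': "p' \<in> prob_simplex" "\<And>q. q \<in> prob_simplex \<Longrightarrow> objective \<pi> q \<le> objective \<pi> p'"
  shows "p = p'"
proof -
  define x where "x = shrink c h \<pi> p *\<^sub>R p"
  define y where "y = shrink c h \<pi> p' *\<^sub>R p'"
  define m where "m = (x + y) /\<^sub>R 2"
  note pos = shrink_props(1)[OF \<pi> p(1)] shrink_props(1)[OF \<pi> p'(1)]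
  have x1: "x \<bullet> 1 = shrink c h \<pi> p"
    using p(1) by (simp add: x_def prob_simplex_def)
  have x: "x \<in> orthant" "x \<noteq> 0" "x \<bullet> 1 + cost c h (x - \<pi>) = 1"
    using pos shrink_props(2)[OF \<pi> p(1)] simplex_nonzero[OF p(1)] unfolding x1
    by (auto intro!: orthant_scaleR[OF simplex_orthant[OF p(1)]] simp: x_def)
  have y1: "y \<bullet> 1 = shrink c h \<pi> p'"
    using p'(1) by (simp add: y_def prob_simplex_def)
  have y: "y \<in> orthant" "y \<noteq> 0" "y \<bullet> 1 + cost c h (y - \<pi>) = 1"
    using pos shrink_props(2)[OF \<pi> p'(1)] simplex_nonzero[OF p'(1)] unfolding y1
    by (auto intro!: orthant_scaleR[OF simplex_orthant[OF p'(1)]] simp: y_def)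
  have m1: "m \<bullet> 1 = (x \<bullet> 1 + y \<bullet> 1) / 2"
    by (simp add: m_def inner_add_left)
  have m: "m \<in> orthant" "m \<noteq> 0"
    using x(1) y(1) m1 x1 y1 pos by (auto simp: m_def orthant_def)
  have "m - \<pi> = ((x - \<pi>) + (y - \<pi>)) /\<^sub>R 2"
    by (simp add: m_def vec_eq_iff field_simps)
  hence "cost c h (m - \<pi>) \<le> (cost c h (x - \<pi>) + cost c h (y - \<pi>)) / 2"
    using cost_midpoint[of c h "x - \<pi>" "y - \<pi>"] by (simp only:)
  hence "m \<bullet> 1 + cost c h (m - \<pi>) \<le> 1"
    using m1 x(3) y(3) by (simp add: field_simps)
  from util_le_objective[OF \<pi> m this]
  have le: "util m \<le> util x" "util m \<le> util y"
    using p(2)[OF orthant_normalize[OF m]] p'(2)[OF orthant_normalize[OF m]]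
    by (simp_all add: x_def y_def objective_eq_util[OF \<pi> p(1)] objective_eq_util[OF \<pi> p'(1)])
  have mid: "(ln (lift v (x * R \<omega>)) + ln (lift v (y * R \<omega>))) / 2 \<le> ln (lift v (m * R \<omega>))"
      "lift v (x * R \<omega>) \<noteq> lift v (y * R \<omega>) \<Longrightarrow>
      (ln (lift v (x * R \<omega>)) + ln (lift v (y * R \<omega>))) / 2 < ln (lift v (m * R \<omega>))"
    if \<omega>: "\<omega> \<in> space M" for \<omega>
  proof -
    have "m * R \<omega> = (x * R \<omega> + y * R \<omega>) /\<^sub>R 2"
      by (simp add: m_def distrib_right)
    thus "(ln (lift v (x * R \<omega>)) + ln (lift v (y * R \<omega>))) / 2 \<le> ln (lift v (m * R \<omega>))"
      "lift v (x * R \<omega>) \<noteq> lift v (y * R \<omega>) \<Longrightarrow>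
      (ln (lift v (x * R \<omega>)) + ln (lift v (y * R \<omega>))) / 2 < ln (lift v (m * R \<omega>))"
      using ln_lift_midpoint[OF concave, of "x * R \<omega>" "y * R \<omega>"] x y
        orthant_mult R_orthant[OF \<omega>] mult_pos_vec_nonzero R_pos[OF \<omega>]
      by metis+
  qed
  have "AE \<omega> in M. ln (lift v (x * R \<omega>)) = ln (lift v (y * R \<omega>))"
  proof (rule AE_eq_if_entropic_midpoint_le[OF nonpos])
    show "entropic M \<gamma> (\<lambda>\<omega>. ln (lift v (m * R \<omega>))) \<le> entropic M \<gamma> (\<lambda>\<omega>. ln (lift v (x * R \<omega>)))"
      "entropic M \<gamma> (\<lambda>\<omega>. ln (lift v (m * R \<omega>))) \<le> entropic M \<gamma> (\<lambda>\<omega>. ln (lift v (y * R \<omega>)))"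
      using le by (simp_all add: util_def)
    show "(ln (lift v (x * R \<omega>)) + ln (lift v (y * R \<omega>))) / 2 < ln (lift v (m * R \<omega>))"
      if "\<omega> \<in> space M" "ln (lift v (x * R \<omega>)) \<noteq> ln (lift v (y * R \<omega>))" for \<omega>
      by (rule mid(2)) (use that in auto)
  qed (use mid(1) x y m in \<open>auto intro: util_integrable\<close>)
  hence "AE \<omega> in M. lift v (x * R \<omega>) = lift v (y * R \<omega>)"
  proof (rule AE_mp, intro AE_I2 impI)
    fix \<omega> assume \<omega>: "\<omega> \<in> space M" and "ln (lift v (x * R \<omega>)) = ln (lift v (y * R \<omega>))"
    thus "lift v (x * R \<omega>) = lift v (y * R \<omega>)"
      using lift_R_pos[OF \<omega> x(1,2)] lift_R_pos[OF \<omega> y(1,2)] by simp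
  qed
  hence "x = y" by (rule separating[OF x(1) y(1)])
  hence "shrink c h \<pi> p = shrink c h \<pi> p'" using x1 y1 by simp
  with \<open>x = y\<close> pos show ?thesis by (simp add: x_def y_def)
qed

lemma maximizer_exists:
  assumes \<pi>: "\<pi> \<in> prob_simplex"
  shows "\<exists>p\<in>prob_simplex. \<forall>q\<in>prob_simplex. objective \<pi> q \<le> objective \<pi> p"
proof (rule continuous_attains_sup[OF compact_prob_simplex])
  show "(prob_simplex :: (real ^ 'd) set) \<noteq> {}" using axis_in_simplex by blast
  show "continuous_on prob_simplex (objective \<pi>)"
    using continuous_on_compose2[OF continuous_on_objective, of prob_simplex "\<lambda>q. (\<pi>, q)"] \<pi>
    by (force intro!: continuous_intros)
qed

theorem unique_continuous_maximizer:
  defines "maximizer \<equiv> \<lambda>\<pi> p. p \<in> prob_simplex \<and> (\<forall>q\<in>prob_simplex. objective \<pi> q \<le> objective \<pi> p)"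
  shows "\<forall>\<pi>\<in>prob_simplex. \<exists>!p. maximizer \<pi> p"
    and "continuous_on prob_simplex (\<lambda>\<pi>. THE p. maximizer \<pi> p)"
proof -
  show ex1: "\<forall>\<pi>\<in>prob_simplex. \<exists>!p. maximizer \<pi> p"
    unfolding maximizer_def using maximizer_exists maximizer_unique by (blast intro: ex1I)
  have the: "maximizer \<pi> (THE p. maximizer \<pi> p)" if "\<pi> \<in> prob_simplex" for \<pi>
    using ex1 that by (blast intro: theI')
  show "continuous_on prob_simplex (\<lambda>\<pi>. THE p. maximizer \<pi> p)"
  proof (rule continuous_on_unique_argmax[OF compact_prob_simplex compact_prob_simplex
        continuous_on_objective])
    fix \<pi> p :: "real ^ 'd"
    assume "\<pi> \<in> prob_simplex" "p \<in> prob_simplex"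
      and "\<forall>q\<in>prob_simplex. objective \<pi> q \<le> objective \<pi> p"
    hence "maximizer \<pi> p" by (simp add: maximizer_def)
    thus "p = (THE p. maximizer \<pi> p)"
      using ex1 \<open>\<pi> \<in> prob_simplex\<close> by (metis the1_equality)
  qed (use the in \<open>auto simp: maximizer_def\<close>)
qed

end

section \<open>The market\<close>

lemma borel_measurable_vecI:
  fixes f :: "'a \<Rightarrow> real ^ 'd"
  assumes "\<And>i. (\<lambda>\<omega>. f \<omega> $ i) \<in> borel_measurable M"
  shows "f \<in> borel_measurable M"
  using assms by (subst borel_measurable_euclidean_space) (auto simp: Basis_vec_def inner_axis)

lemma borel_measurable_vec_component:
  fixes f :: "'a \<Rightarrow> real ^ 'd"
  assumes "f \<in> borel_measurable M"
  shows "(\<lambda>\<omega>. f \<omega> $ i) \<in> borel_measurable M"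
  using borel_measurable_inner[OF assms borel_measurable_const[of "axis i 1"]]
  by (simp add: inner_axis)

locale market = prob_space M for M :: "'a measure" +
  fixes S :: "real \<Rightarrow> 'a \<Rightarrow> real ^ 'd" and \<eta> :: "nat \<Rightarrow> 'a \<Rightarrow> real"
  assumes prices: "price_process M S" and times: "iid_times M S \<eta>" and incr: "increments M S"
begin

text \<open>The \<open>\<sigma>\<close>-algebra generated by the price path. Joint measurability has to be proved relative to
  it, rather than to \<open>M\<close>, since it is the path that is independent of the waiting times.\<close>

abbreviation path_algebra :: "'a measure" where
  "path_algebra \<equiv>
     vimage_algebra (space M) (\<lambda>\<omega>. \<lambda>t\<in>{0..}. S t \<omega>) (PiM {0..} (\<lambda>_. borel))"

lemma price_pos: "0 \<le> t \<Longrightarrow> \<omega> \<in> space M \<Longrightarrow> 0 < S t \<omega> $ i"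
  using prices by (auto simp: price_process_def)

lemma ret_pos: "0 \<le> t \<Longrightarrow> \<omega> \<in> space M \<Longrightarrow> 0 < ret S 0 t \<omega> $ i"
  using price_pos by (simp add: ret_def)

lemma time_pos: "\<omega> \<in> space M \<Longrightarrow> 0 < \<eta> 1 \<omega>"
  using times by (auto simp: iid_times_def)

lemma time_measurable: "\<eta> 1 \<in> borel_measurable M"
proof -
  have "indep_vars (\<lambda>_. borel) \<eta> {1..}" using times by (simp add: iid_times_def)
  thus ?thesis by (auto simp: indep_vars_def)
qed

lemma price_path_measurable:
  assumes "0 \<le> t"
  shows "S t \<in> borel_measurable path_algebra"
proof -
  have "(\<lambda>\<omega>. \<lambda>t\<in>{0..}. S t \<omega>) \<in> measurable path_algebra (PiM {0..} (\<lambda>_. borel))"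
    by (rule measurable_vimage_algebra1) (auto simp: space_PiM)
  from measurable_compose[OF this measurable_component_singleton[of t]] show ?thesis
    using assms by simp
qed

lemma ret_path_measurable:
  assumes t: "0 \<le> t"
  shows "ret S 0 t \<in> borel_measurable path_algebra"
proof (rule borel_measurable_vecI)
  fix i
  have [measurable]: "(\<lambda>\<omega>. S t \<omega> $ i) \<in> borel_measurable path_algebra"
      "(\<lambda>\<omega>. S 0 \<omega> $ i) \<in> borel_measurable path_algebra"
    using t by (auto intro!: borel_measurable_vec_component price_path_measurable)
  show "(\<lambda>\<omega>. ret S 0 t \<omega> $ i) \<in> borel_measurable path_algebra"
    by (simp add: ret_def)
qed

text \<open>Right-continuity is assumed for the logarithms of the prices; exponentiate.\<close>

lemma ret_right_continuous:
  assumes t: "0 \<le> t" and \<omega>: "\<omega> \<in> space M"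
  shows "((\<lambda>u. ret S 0 u \<omega>) \<longlongrightarrow> ret S 0 t \<omega>) (at_right t)"
proof (rule vec_tendstoI)
  fix i
  have "((\<lambda>u. log_price S u \<omega>) \<longlongrightarrow> log_price S t \<omega>) (at_right t)"
    using incr t \<omega> by (auto simp: increments_def continuous_within)
  hence "((\<lambda>u. exp (log_price S u \<omega> $ i) / S 0 \<omega> $ i) \<longlongrightarrow> exp (log_price S t \<omega> $ i) / S 0 \<omega> $ i)
      (at_right t)"
    using price_pos[OF order_refl \<omega>, of i] by (intro tendsto_intros tendsto_vec_nth) auto
  moreover have "\<forall>\<^sub>F u in at_right t. exp (log_price S u \<omega> $ i) / S 0 \<omega> $ i = ret S 0 u \<omega> $ i"
    using eventually_at_right_less[of t]
    by eventually_elim (use t price_pos[OF _ \<omega>] in \<open>simp add: log_price_def ret_def\<close>)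
  moreover have "exp (log_price S t \<omega> $ i) / S 0 \<omega> $ i = ret S 0 t \<omega> $ i"
    using price_pos[OF t \<omega>] by (simp add: log_price_def ret_def)
  ultimately show "((\<lambda>u. ret S 0 u \<omega> $ i) \<longlongrightarrow> ret S 0 t \<omega> $ i) (at_right t)"
    by (simp add: tendsto_cong)
qed

lemma ret_jointly_measurable:
  "(\<lambda>z. ret S 0 (max 0 (fst z)) (snd z)) \<in> borel_measurable (borel \<Otimes>\<^sub>M path_algebra)"
  by (rule right_continuous_jointly_measurable)
     (use ret_path_measurable ret_right_continuous in auto)

lemma path_algebra_le: "(\<lambda>\<omega>. \<omega>) \<in> measurable M path_algebra"
proof (rule measurable_vimage_algebra2)
  show "(\<lambda>\<omega>. \<lambda>t\<in>{0..}. S t \<omega>) \<in> measurable M (PiM {0..} (\<lambda>_. borel))"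
    using prices by (intro measurable_restrict) (auto simp: price_process_def)
qed auto

text \<open>The first waiting time is a coordinate of the whole sequence and therefore measurable with
  respect to the \<open>\<sigma>\<close>-algebra which that sequence generates.\<close>

lemma time_indep_path:
  assumes I: "I \<in> sets borel" and B: "B \<in> sets path_algebra"
  shows "prob ((\<eta> 1 -` I \<inter> space M) \<inter> B) = prob (\<eta> 1 -` I \<inter> space M) * prob B"
proof (rule indep_setD)
  let ?T = "vimage_algebra (space M) (\<lambda>\<omega>. \<lambda>i\<in>{1..}. \<eta> i \<omega>) (PiM {1..} (\<lambda>_. borel))"
  show "indep_set (sets ?T) (sets path_algebra)"
    using times by (simp add: iid_times_def)
  have "(\<lambda>\<omega>. \<lambda>i\<in>{1..}. \<eta> i \<omega>) \<in> measurable ?T (PiM {1..} (\<lambda>_. borel))"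
    by (rule measurable_vimage_algebra1) (auto simp: space_PiM)
  from measurable_compose[OF this measurable_component_singleton[of 1]]
  have "\<eta> 1 \<in> borel_measurable ?T" by simp
  from measurable_sets[OF this I] show "\<eta> 1 -` I \<inter> space M \<in> sets ?T" by simp
qed (rule B)

abbreviation R :: "'a \<Rightarrow> real ^ 'd" where
  "R \<omega> \<equiv> ret S 0 (\<eta> 1 \<omega>) \<omega>"

lemma R_measurable: "R \<in> borel_measurable M"
  by (rule measurable_at_independent_time[OF time_measurable path_algebra_le _ ret_jointly_measurable])
     (use time_pos in \<open>auto simp: less_imp_le\<close>)

text \<open>If \<open>x\<close> and \<open>y\<close> differ in coordinate \<open>i\<close>, the lifts of \<open>x \<cdot> \<rho>\<close> and \<open>y \<cdot> \<rho>\<close> differ at the vertex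
  \<open>\<rho> = e\<^sub>i\<close> and hence on a nonempty relatively open set \<open>C\<close> of directions. Full support gives \<open>C\<close>
  positive probability at each fixed time, and so also at the waiting time.\<close>

lemma lift_separating:
  assumes supp: "full_support M S" and v: "continuous_on prob_simplex v"
    and x: "x \<in> orthant" and y: "y \<in> orthant"
    and eq: "AE \<omega> in M. lift v (x * R \<omega>) = lift v (y * R \<omega>)"
  shows "x = y"
proof (rule ccontr)
  assume "x \<noteq> y"
  then obtain i where i: "x $ i \<noteq> y $ i" by (auto simp: vec_eq_iff)
  define f where "f r = lift v (x * r) - lift v (y * r)" for r
  define A where "A = orthant \<inter> f -` (- {0})"
  define C where "C = prob_simplex \<inter> f -` (- {0})"
  have f: "continuous_on orthant f"
    unfolding f_def using x y
    by (intro continuous_intros continuous_on_compose2[OF continuous_on_lift[OF v]])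
       (auto intro: orthant_mult)
  have f_scale: "f (a *\<^sub>R r) = a * f r" if "0 \<le> a" for a r
    using that by (simp add: f_def lift_scaleR right_diff_distrib)
  have A: "A \<in> sets borel"
  proof -
    have "(\<lambda>r. indicator orthant r *\<^sub>R f r) \<in> borel_measurable borel"
      by (intro borel_measurable_continuous_on_indicator f) (simp add: closed_orthant borel_closed)
    from measurable_sets[OF this, of "- {0}"]
    have "(\<lambda>r. indicator orthant r *\<^sub>R f r) -` (- {0}) \<in> sets borel" by simp
    also have "(\<lambda>r. indicator orthant r *\<^sub>R f r) -` (- {0}) = A"
      by (auto simp: A_def indicator_def)
    finally show ?thesis .
  qed
  have C: "openin (top_of_set prob_simplex) C"
    unfolding C_def
    by (intro continuous_openin_preimage_gen continuous_on_subset[OF f])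
       (auto intro: simplex_orthant)
  have "f (axis i 1) \<noteq> 0"
  proof -
    have "z * axis i 1 = (z $ i) *\<^sub>R axis i 1" for z :: "real ^ 'd"
      by (simp add: vec_eq_iff axis_def)
    hence "f (axis i 1) = (x $ i - y $ i) * lift v (axis i 1)"
      using x y by (simp add: f_def lift_scaleR orthant_def left_diff_distrib)
    moreover have "0 < lift v (axis i 1)"
      by (intro lift_pos simplex_orthant simplex_nonzero axis_in_simplex)
    ultimately show ?thesis using i by simp
  qed
  hence C_ne: "C \<noteq> {}" using axis_in_simplex[of i] by (auto simp: C_def)
  \<comment> \<open>For the uniform portfolio, \<open>G u r\<close> is the direction of \<open>r\<close>.\<close>
  define u :: "real ^ 'd" where "u = (\<chi> i. 1 / real CARD('d))"
  have u: "u \<in> prob_simplex0"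
    by (auto simp: u_def prob_simplex0_def prob_simplex_def inner_one_eq_sum)
  have Gu: "G u r = r /\<^sub>R (r \<bullet> 1)" for r
  proof -
    have "u * r = (1 / real CARD('d)) *\<^sub>R r" "u \<bullet> r = (1 / real CARD('d)) * (r \<bullet> 1)"
      by (simp_all add: u_def vec_eq_iff inner_vec_def sum_divide_distrib)
    thus ?thesis by (simp add: G_def inverse_eq_divide)
  qed
  have "0 < prob {\<omega> \<in> space M. R \<omega> \<in> A}"
  proof (rule prob_at_independent_time_pos[OF time_measurable path_algebra_le _ time_indep_path
        time_pos ret_jointly_measurable A])
    fix t :: real assume t: "0 < t"
    have "ret S 0 t \<omega> \<in> A \<longleftrightarrow> G u (ret S 0 t \<omega>) \<in> C" if \<omega>: "\<omega> \<in> space M" for \<omega>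
    proof -
      have r: "ret S 0 t \<omega> \<in> orthant" "ret S 0 t \<omega> \<noteq> 0"
        using ret_pos[OF less_imp_le[OF t] \<omega>] by (force simp: orthant_def less_imp_le)+
      have pos: "0 < ret S 0 t \<omega> \<bullet> 1" by (rule orthant_inner_one_pos[OF r])
      thus ?thesis
        using r orthant_normalize[OF r] f_scale[of "inverse (ret S 0 t \<omega> \<bullet> 1)" "ret S 0 t \<omega>"]
        by (simp add: A_def C_def Gu)
    qed
    hence "{\<omega> \<in> space M. ret S 0 t \<omega> \<in> A} = {\<omega> \<in> space M. G u (ret S 0 t \<omega>) \<in> C}" by auto
    thus "0 < prob {\<omega> \<in> space M. ret S 0 t \<omega> \<in> A}"
      using supp u t C C_ne by (simp add: full_support_def)
  qed simp_all
  moreover have "prob {\<omega> \<in> space M. R \<omega> \<in> A} = 0"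
  proof -
    have "AE \<omega> in M. R \<omega> \<notin> A"
      using eq by eventually_elim (simp add: A_def f_def)
    moreover note R_measurable[measurable] A[measurable]
    ultimately show ?thesis
      by (subst (asm) AE_iff_measurable[OF _ refl]) (auto simp: emeasure_eq_measure)
  qed
  ultimately show False by simp
qed

text \<open>The negative part of the minimum is dominated by \<open>exp (- min)\<close>, the case \<open>\<gamma> = -1\<close> of the
  integrability condition, and its positive part by the maximum.\<close>

lemma log_ret_min_integrable:
  assumes "integrability M S \<eta>"
  shows "integrable M (\<lambda>\<omega>. MIN i. log_ret S (\<eta> 1 \<omega>) \<omega> $ i)"
proof -
  let ?lo = "\<lambda>\<omega>. MIN i. log_ret S (\<eta> 1 \<omega>) \<omega> $ i"
  let ?hi = "\<lambda>\<omega>. MAX i. log_ret S (\<eta> 1 \<omega>) \<omega> $ i"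
  have "integrable M (\<lambda>\<omega>. exp (\<gamma> * ?lo \<omega>))" if "\<gamma> < 0" for \<gamma>
    using assms that by (simp add: integrability_def)
  from this[of "- 1"] have e: "integrable M (\<lambda>\<omega>. exp (- ?lo \<omega>))" by simp
  have hi: "integrable M ?hi" using assms by (simp add: integrability_def)
  \<comment> \<open>Measurability of the minimum is read off from that of its exponential.\<close>
  have "(\<lambda>\<omega>. - ln (exp (- ?lo \<omega>))) \<in> borel_measurable M"
    using borel_measurable_integrable[OF e] by measurable
  hence meas: "?lo \<in> borel_measurable M" by (simp only: ln_exp minus_minus)
  show ?thesis
  proof (rule Bochner_Integration.integrable_bound[OF _ meas])
    show "integrable M (\<lambda>\<omega>. exp (- ?lo \<omega>) + \<bar>?hi \<omega>\<bar>)" using e hi by simp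
    show "AE \<omega> in M. norm (?lo \<omega>) \<le> norm (exp (- ?lo \<omega>) + \<bar>?hi \<omega>\<bar>)"
    proof (intro AE_I2)
      fix \<omega>
      have "?lo \<omega> \<le> ?hi \<omega>"
        by (rule order_trans[OF Min_le Max_ge, of _ "log_ret S (\<eta> 1 \<omega>) \<omega> $ undefined"]) auto
      moreover have "1 + (- ?lo \<omega>) \<le> exp (- ?lo \<omega>)" "0 < exp (- ?lo \<omega>)"
        by (rule exp_ge_add_one_self exp_gt_zero)+
      ultimately show "norm (?lo \<omega>) \<le> norm (exp (- ?lo \<omega>) + \<bar>?hi \<omega>\<bar>)"
        unfolding real_norm_def by linarith
    qed
  qed
qed

end

section \<open>The Bellman equation\<close>

lemma bellman_attained_iff:
  "bellman_attained M S \<eta> c h \<gamma> v lam \<pi> p \<longleftrightarrow> p \<in> prob_simplex \<and>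
    (\<forall>q\<in>prob_simplex. bellman_obj M S \<eta> c h \<gamma> v lam \<pi> q \<le> bellman_obj M S \<eta> c h \<gamma> v lam \<pi> p)"
  (is "?L \<longleftrightarrow> ?R")
proof
  let ?f = "bellman_obj M S \<eta> c h \<gamma> v lam \<pi>"
  have upper: "ereal (?f q) \<le> bellman_sup M S \<eta> c h \<gamma> v lam \<pi>" if "q \<in> prob_simplex" for q
    unfolding bellman_sup_def using that by (rule SUP_upper)
  show "?R" if "?L"
    using that upper unfolding bellman_attained_def by (metis ereal_less_eq(3))
  assume R: "?R"
  have "bellman_sup M S \<eta> c h \<gamma> v lam \<pi> \<le> ereal (?f p)"
    unfolding bellman_sup_def using R by (intro SUP_least) simp
  thus "?L" using upper[of p] R by (auto simp: bellman_attained_def intro: antisym)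
qed

theorem theorem3p14:
  fixes M :: "'a measure"
    and S :: "real \<Rightarrow> 'a \<Rightarrow> real ^ 'd"
    and \<eta> :: "nat \<Rightarrow> 'a \<Rightarrow> real"
    and c h :: "real ^ 'd"
    and \<gamma> lam :: real
    and v :: "real ^ 'd \<Rightarrow> real"
  assumes "prob_space M"
    and "\<forall>i. 0 \<le> c $ i \<and> c $ i < 1"
    and "\<forall>i. 0 \<le> h $ i \<and> h $ i < 1"
    and "price_process M S"
    and "iid_times M S \<eta>"
    and "increments M S"
    and "waiting_times M \<eta>"
    and "integrability M S \<eta>"
    and "full_support M S"
    and "\<gamma> \<le> 0"
    and "continuous_on prob_simplex v" and "bounded (v ` prob_simplex)"
    and "\<forall>\<pi>\<in>prob_simplex. ereal (v \<pi>) = bellman_sup M S \<eta> c h \<gamma> v lam \<pi>"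
    and "concave_on orthant (lift v)"
  shows "(\<forall>\<pi>\<in>prob_simplex. \<exists>!\<pi>'. bellman_attained M S \<eta> c h \<gamma> v lam \<pi> \<pi>') \<and>
         continuous_on prob_simplex (\<lambda>\<pi>. THE \<pi>'. bellman_attained M S \<eta> c h \<gamma> v lam \<pi> \<pi>')"
proof -
  interpret market M S \<eta>
    using assms by (simp add: market_def market_axioms_def)
  let ?lo = "\<lambda>\<omega>. MIN i. log_ret S (\<eta> 1 \<omega>) \<omega> $ i"
  let ?hi = "\<lambda>\<omega>. MAX i. log_ret S (\<eta> 1 \<omega>) \<omega> $ i"
  interpret one_period_problem M c h R ?lo ?hi v \<gamma>
  proof
    show "integrable M (\<lambda>\<omega>. exp (\<gamma> * ?lo \<omega>))"
      using assms(8,10) by (cases "\<gamma> = 0") (auto simp: integrability_def)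
    show "?lo \<omega> \<le> ln (R \<omega> $ i) \<and> ln (R \<omega> $ i) \<le> ?hi \<omega>" for \<omega> i
    proof -
      have "ln (R \<omega> $ i) = log_ret S (\<eta> 1 \<omega>) \<omega> $ i" by (simp add: log_ret_def)
      thus ?thesis by (auto intro!: Min_le Max_ge)
    qed
    show "0 < R \<omega> $ i" if "\<omega> \<in> space M" for \<omega> i
      using ret_pos[OF less_imp_le[OF time_pos[OF that]] that] .
    show "x = y" if "x \<in> orthant" "y \<in> orthant" "AE \<omega> in M. lift v (x * R \<omega>) = lift v (y * R \<omega>)" for x y
      using lift_separating[OF assms(9,11) that] .
  qed (use assms R_measurable log_ret_min_integrable in \<open>auto simp: integrability_def\<close>)
  have obj: "bellman_obj M S \<eta> c h \<gamma> v lam \<pi> q = objective \<pi> q - lam * expectation (\<eta> 1)"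
    if q: "q \<in> prob_simplex" for \<pi> q
  proof -
    have "entropic M \<gamma> (\<lambda>\<omega>. ln (q \<bullet> R \<omega>) + v (G q (R \<omega>))) = util q"
      unfolding util_def
    proof (rule entropic_cong)
      fix \<omega> assume \<omega>: "\<omega> \<in> space M"
      have nz: "q * R \<omega> \<noteq> 0"
        by (rule mult_pos_vec_nonzero[OF simplex_nonzero[OF q] R_pos[OF \<omega>]])
      have "0 < q \<bullet> R \<omega>"
        using orthant_inner_one_pos[OF orthant_mult nz] simplex_orthant[OF q] R_orthant[OF \<omega>]
        by (simp add: mult_inner_one)
      thus "ln (q \<bullet> R \<omega>) + v (G q (R \<omega>)) = ln (lift v (q * R \<omega>))"
        unfolding lift_mult_eq[OF nz] by (simp add: ln_mult)
    qed
    thus ?thesis unfolding bellman_obj_def objective_def by (simp del: One_nat_def)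
  qed
  have "bellman_attained M S \<eta> c h \<gamma> v lam \<pi> p \<longleftrightarrow>
      p \<in> prob_simplex \<and> (\<forall>q\<in>prob_simplex. objective \<pi> q \<le> objective \<pi> p)" for \<pi> p
    unfolding bellman_attained_iff using obj by auto
  thus ?thesis using unique_continuous_maximizer by simp
qed

end
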